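(* Let $\bar X\in\mathbb{R}_{\ge0}^{m\times n}$ and suppose $(p,q)$ are the row and column sums of a draw $Y$ from the biproportional Poisson model with base matrix $\bar X$ and true parameters $(u^*,v^* )$. Let $\mathcal L$ be the Laplacian of $\bar X$ and assume $\lambda_{-2}(\mathcal L)>0$. Let $B>0$, and let $\mathcal B$ be the event that a maximizer $(\hat u,\hat v)$ of $\ell$ exists satisfying the normalization $(\hat u-u^*,\hat v-v^* )\perp\mathbf 1_{m+n}$ and $\|(\hat u,\hat v,u^*,v^* )\|_\infty\le B$. Let $\kappa=\sum_{ij}e^{u^*_i}\bar X_{ij}e^{-v^*_j}$ and $M=\max\{\max_i\sum_je^{u^*_i}\bar X_{ij}e^{-v^*_j},\ \max_j\sum_ie^{u^*_i}\bar X_{ij}e^{-v^*_j}\}$. Then $$\mathbb E\big[\|(\hat u-u^*,\hat v-v^* )\|_2^2\,\mathbf 1_{\mathcal B}\big]\le\frac{8e^{4B}\kappa}{\lambda_{-2}(\mathcal L)^2}.$$ Moreover there is an absolute constant $C>0$ such that for every $\delta\in(0,1)$, with probability at least $1-\delta$, on the event $\mathcal B$, $$\|(\hat u-u^*,\hat v-v^* )\|_2^2\le\frac{8e^{4B}}{\lambda_{-2}(\mathcal L)^2}\Big(\kappa+\sqrt{6\log(4/\delta)\,\kappa(1+M)}+C\log^2(12/\delta)\log^2(1+m+n)(1+M)\Big).$$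
   Context: Biproportional Poisson model: given $\bar X\in\mathbb{R}_{\ge0}^{m\times n}$ and $u\in\mathbb{R}^m$, $v\in\mathbb{R}^n$, entries $Y_{ij}$ are independent with $Y_{ij}\sim\mathrm{Poisson}(e^{u_i}\bar X_{ij}e^{-v_j})$ if $\bar X_{ij}>0$ and $Y_{ij}=0$ otherwise; $p_i=\sum_jY_{ij}$, $q_j=\sum_iY_{ij}$. Log-likelihood: $\ell(u,v)=\sum_ip_iu_i-\sum_jq_jv_j-\sum_{ij}\bar X_{ij}e^{u_i-v_j}$. Laplacian of $\bar X$: the $(m+n)\times(m+n)$ matrix $\mathcal L=\begin{bmatrix}\mathrm{diag}(\bar X\mathbf 1_n)&-\bar X\\-\bar X^T&\mathrm{diag}(\bar X^T\mathbf 1_m)\end{bmatrix}$ (the Laplacian of the weighted bipartite graph with adjacency $\begin{bmatrix}0&\bar X\\\bar X^T&0\end{bmatrix}$); $\lambda_{-2}(\cdot)$ denotes the second-smallest eigenvalue. *)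

theory Defs
  imports "HOL-Probability.Probability" "HOL-Computational_Algebra.Polynomial"
    "Jordan_Normal_Form.Char_Poly"
begin

text \<open>Base matrix X is represented as X :: nat => nat => real with entries X i j, i < m, j < n.
  Parameters u, v are functions nat => real, only indices i < m resp. j < n matter.\<close>

definition rate :: "(nat \<Rightarrow> nat \<Rightarrow> real) \<Rightarrow> (nat \<Rightarrow> real) \<Rightarrow> (nat \<Rightarrow> real) \<Rightarrow> nat \<Rightarrow> nat \<Rightarrow> real" where
  "rate X u v i j = exp (u i) * X i j * exp (- v j)"

definition bpm_pmf :: "nat \<Rightarrow> nat \<Rightarrow> (nat \<Rightarrow> nat \<Rightarrow> real) \<Rightarrow> (nat \<Rightarrow> real) \<Rightarrow> (nat \<Rightarrow> real)
    \<Rightarrow> (nat \<times> nat \<Rightarrow> nat) pmf" where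
  "bpm_pmf m n X u v = Pi_pmf ({0..<m} \<times> {0..<n}) 0
     (\<lambda>(i,j). if X i j > 0 then poisson_pmf (rate X u v i j) else return_pmf 0)"

definition rowsum :: "nat \<Rightarrow> (nat \<times> nat \<Rightarrow> nat) \<Rightarrow> nat \<Rightarrow> nat" where
  "rowsum n Y i = (\<Sum>j<n. Y (i,j))"

definition colsum :: "nat \<Rightarrow> (nat \<times> nat \<Rightarrow> nat) \<Rightarrow> nat \<Rightarrow> nat" where
  "colsum m Y j = (\<Sum>i<m. Y (i,j))"

definition loglik :: "nat \<Rightarrow> nat \<Rightarrow> (nat \<Rightarrow> nat \<Rightarrow> real) \<Rightarrow> (nat \<Rightarrow> nat) \<Rightarrow> (nat \<Rightarrow> nat)
    \<Rightarrow> (nat \<Rightarrow> real) \<Rightarrow> (nat \<Rightarrow> real) \<Rightarrow> real" where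
  "loglik m n X p q u v = (\<Sum>i<m. real (p i) * u i) - (\<Sum>j<n. real (q j) * v j)
     - (\<Sum>i<m. \<Sum>j<n. X i j * exp (u i - v j))"

definition is_mle :: "nat \<Rightarrow> nat \<Rightarrow> (nat \<Rightarrow> nat \<Rightarrow> real) \<Rightarrow> (nat \<Rightarrow> nat) \<Rightarrow> (nat \<Rightarrow> nat)
    \<Rightarrow> (nat \<Rightarrow> real) \<Rightarrow> (nat \<Rightarrow> real) \<Rightarrow> bool" where
  "is_mle m n X p q uh vh \<longleftrightarrow> (\<forall>u v. loglik m n X p q u v \<le> loglik m n X p q uh vh)"

definition good_mle :: "nat \<Rightarrow> nat \<Rightarrow> (nat \<Rightarrow> nat \<Rightarrow> real) \<Rightarrow> (nat \<Rightarrow> real) \<Rightarrow> (nat \<Rightarrow> real) \<Rightarrow> real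
    \<Rightarrow> (nat \<Rightarrow> nat) \<Rightarrow> (nat \<Rightarrow> nat) \<Rightarrow> (nat \<Rightarrow> real) \<Rightarrow> (nat \<Rightarrow> real) \<Rightarrow> bool" where
  "good_mle m n X us vs B p q uh vh \<longleftrightarrow> is_mle m n X p q uh vh
     \<and> (\<Sum>i<m. uh i - us i) + (\<Sum>j<n. vh j - vs j) = 0
     \<and> (\<forall>i<m. \<bar>uh i\<bar> \<le> B \<and> \<bar>us i\<bar> \<le> B) \<and> (\<forall>j<n. \<bar>vh j\<bar> \<le> B \<and> \<bar>vs j\<bar> \<le> B)"

definition event_B :: "nat \<Rightarrow> nat \<Rightarrow> (nat \<Rightarrow> nat \<Rightarrow> real) \<Rightarrow> (nat \<Rightarrow> real) \<Rightarrow> (nat \<Rightarrow> real) \<Rightarrow> real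
    \<Rightarrow> (nat \<times> nat \<Rightarrow> nat) \<Rightarrow> bool" where
  "event_B m n X us vs B Y \<longleftrightarrow>
     (\<exists>uh vh. good_mle m n X us vs B (rowsum n Y) (colsum m Y) uh vh)"

definition sq_err :: "nat \<Rightarrow> nat \<Rightarrow> (nat \<Rightarrow> real) \<Rightarrow> (nat \<Rightarrow> real) \<Rightarrow> (nat \<Rightarrow> real) \<times> (nat \<Rightarrow> real) \<Rightarrow> real" where
  "sq_err m n us vs e = (\<Sum>i<m. (fst e i - us i)^2) + (\<Sum>j<n. (snd e j - vs j)^2)"

text \<open>Laplacian of the bipartite graph with adjacency [[0,X],[X^T,0]], as an (m+n)x(m+n) matrix.\<close>
definition laplacian :: "nat \<Rightarrow> nat \<Rightarrow> (nat \<Rightarrow> nat \<Rightarrow> real) \<Rightarrow> real mat" where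
  "laplacian m n X = mat (m+n) (m+n) (\<lambda>(a,b).
     if a < m \<and> b < m then (if a = b then (\<Sum>j<n. X a j) else 0)
     else if a < m then - X a (b - m)
     else if b < m then - X b (a - m)
     else (if a = b then (\<Sum>i<m. X i (a - m)) else 0))"

definition eigenvalues_sorted :: "real mat \<Rightarrow> real list" where
  "eigenvalues_sorted A = sorted_list_of_multiset (proots (char_poly A))"

definition lambda_2 :: "real mat \<Rightarrow> real" where
  "lambda_2 A = eigenvalues_sorted A ! 1"

definition kappa :: "nat \<Rightarrow> nat \<Rightarrow> (nat \<Rightarrow> nat \<Rightarrow> real) \<Rightarrow> (nat \<Rightarrow> real) \<Rightarrow> (nat \<Rightarrow> real) \<Rightarrow> real" where
  "kappa m n X us vs = (\<Sum>i<m. \<Sum>j<n. rate X us vs i j)"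

definition Mmax :: "nat \<Rightarrow> nat \<Rightarrow> (nat \<Rightarrow> nat \<Rightarrow> real) \<Rightarrow> (nat \<Rightarrow> real) \<Rightarrow> (nat \<Rightarrow> real) \<Rightarrow> real" where
  "Mmax m n X us vs = max (Max ((\<lambda>i. \<Sum>j<n. rate X us vs i j) ` {..<m}))
                          (Max ((\<lambda>j. \<Sum>i<m. rate X us vs i j) ` {..<n}))"

text \<open>Standing hypotheses. The estimator est is any selection that, from the row and column sums,
  returns a good maximizer whenever one exists.\<close>
definition setting :: "nat \<Rightarrow> nat \<Rightarrow> (nat \<Rightarrow> nat \<Rightarrow> real) \<Rightarrow> (nat \<Rightarrow> real) \<Rightarrow> (nat \<Rightarrow> real) \<Rightarrow> real
    \<Rightarrow> ((nat \<Rightarrow> nat) \<Rightarrow> (nat \<Rightarrow> nat) \<Rightarrow> (nat \<Rightarrow> real) \<times> (nat \<Rightarrow> real)) \<Rightarrow> bool" where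
  "setting m n X us vs B est \<longleftrightarrow> 0 < m \<and> 0 < n \<and> (\<forall>i j. 0 \<le> X i j)
     \<and> lambda_2 (laplacian m n X) > 0 \<and> B > 0
     \<and> (\<forall>p q. (\<exists>uh vh. good_mle m n X us vs B p q uh vh)
              \<longrightarrow> good_mle m n X us vs B p q (fst (est p q)) (snd (est p q)))"

end

theory Submission
  imports Defs
begin

text \<open>
  The likelihood is stationary at its maximizer. Pairing this stationarity with the error vector
  \<open>e\<close>, and using that \<open>exp\<close> is strongly monotone with constant \<open>exp (- 2B)\<close> on \<open>[-2B, 2B]\<close>, bounds
  \<open>exp (- 2B)\<close> times the Laplacian form of \<open>e\<close> by the inner product of \<open>e\<close> with the centered
  marginals. As \<open>e\<close> is orthogonal to the constants, the Laplacian form is at least \<open>\<lambda>\<^sub>2\<close> times the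
  squared norm of \<open>e\<close>, so by Cauchy-Schwarz the squared error is at most \<open>exp (4B) / \<lambda>\<^sub>2\<^sup>2\<close> times the
  sum \<open>S\<close> of the squared deviations of the marginals from their means.

  Rows (and likewise columns) have independent Poisson sums, so only the Poisson moment generating
  function is needed. It gives \<open>E (Z\<^sup>2 exp (t\<bar>Z\<bar>)) \<le> 4a\<close> for a centered Poisson variable \<open>Z\<close> of
  mean \<open>a \<le> M\<close> and \<open>t = 1 / (8 sqrt (1 + M))\<close>. Hence \<open>E S \<le> 8 \<kappa>\<close>. The squares have no exponential
  moments, but after truncating \<open>\<bar>Z\<bar>\<close> at \<open>T = ln (12 N / \<delta>) / t\<close>, which fails with small
  probability, \<open>Z\<^sup>2\<close> has one at scale \<open>t / T\<close>, and Chernoff's bound applies to the sum.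
\<close>

section \<open>The second smallest eigenvalue\<close>

text \<open>Let \<open>P\<close> be the identity with columns \<open>a\<close> and \<open>b\<close>
  replaced by \<open>f\<close> and \<open>g\<close>. The characteristic matrix sends these columns
  to multiples of \<open>[:-c, 1:]\<close> and \<open>[:-d, 1:]\<close>, so both linear factors come
  out of the determinant of the product, while \<open>det P\<close> is a nonzero scalar.
  Multiplicity is respected: \<open>c = d\<close> yields the squared factor.\<close>

lemma char_poly_dvd_if_two_eigenvectors:
  fixes A :: "'a :: field mat" and f g :: "nat \<Rightarrow> 'a"
  assumes A: "A \<in> carrier_mat N N" and ab: "a < N" "b < N"
    and f: "\<And>i. i < N \<Longrightarrow> (\<Sum>k<N. A $$ (i,k) * f k) = c * f i"
    and g: "\<And>i. i < N \<Longrightarrow> (\<Sum>k<N. A $$ (i,k) * g k) = d * g i"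
    and indep: "f a * g b \<noteq> f b * g a"
  shows "[:-c, 1:] * [:-d, 1:] dvd char_poly A"
proof -
  interpret pc: comm_ring_hom "\<lambda>x :: 'a. [:x:]"
    by unfold_locales (auto simp: one_pCons)
  have neq: "a \<noteq> b" using indep by auto
  define P where "P = mat N N (\<lambda>(i,k). if k = a then f i else if k = b then g i else if i = k then 1 else 0)"
  define C where "C = char_poly_matrix A"
  define B where "B = mat N N (\<lambda>(i,k). if k = a then [:f i:] else if k = b then [:g i:] else C $$ (i,k))"
  define h where "h = (\<lambda>k. if k = a then [:-c, 1:] else if k = b then [:-d, 1:] else 1)"
  define D where "D = mat N N (\<lambda>(i,k). if i = k then h k else 0)"
  have P: "P \<in> carrier_mat N N" and B: "B \<in> carrier_mat N N" and D: "D \<in> carrier_mat N N"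
    by (auto simp: P_def B_def D_def)
  have C: "C \<in> carrier_mat N N" using A by (simp add: C_def)
  have Cik: "C $$ (i,k) = (if i = k then [:0,1:] else 0) + [:- (A $$ (i,k)):]" if "i < N" "k < N" for i k
    using A that by (simp add: C_def char_poly_matrix_def)
  have eig: "(\<Sum>l<N. C $$ (i,l) * [:w l:]) = [:w i:] * [:-e, 1:]"
    if i: "i < N" and w: "\<And>i. i < N \<Longrightarrow> (\<Sum>k<N. A $$ (i,k) * w k) = e * w i" for i w e
  proof -
    have "(\<Sum>l<N. C $$ (i,l) * [:w l:]) = (\<Sum>l<N. (if i = l then [:0, w l:] else 0) + [:- (A $$ (i,l) * w l):])"
      by (intro sum.cong refl) (use i in \<open>auto simp: Cik algebra_simps\<close>)
    also have "\<dots> = [:0, w i:] + [:- (\<Sum>l<N. A $$ (i,l) * w l):]"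
      using i by (simp add: sum.distrib sum_negf flip: pc.hom_sum)
    finally show ?thesis using w[OF i] by (simp add: algebra_simps)
  qed
  have "C * map_mat (\<lambda>x. [:x:]) P = B * D"
  proof (rule eq_matI)
    fix i k assume "i < dim_row (B * D)" "k < dim_col (B * D)"
    hence i: "i < N" and k: "k < N" using B D by auto
    have R: "(B * D) $$ (i,k) = B $$ (i,k) * h k"
    proof -
      have "(B * D) $$ (i,k) = (\<Sum>l\<in>{0..<N}. B $$ (i,l) * D $$ (l,k))"
        using i k B D by (auto simp: scalar_prod_def)
      also have "\<dots> = (\<Sum>l\<in>{0..<N}. if l = k then B $$ (i,l) * h k else 0)"
        by (intro sum.cong refl) (use k in \<open>auto simp: D_def\<close>)
      finally show ?thesis using k by simp
    qed
    have "(C * map_mat (\<lambda>x. [:x:]) P) $$ (i,k) = (\<Sum>l<N. C $$ (i,l) * [:P $$ (l,k):])"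
      using i k C P by (auto simp: scalar_prod_def lessThan_atLeast0)
    also have "\<dots> = B $$ (i,k) * h k"
    proof -
      consider "k = a" | "k = b" | "k \<noteq> a" "k \<noteq> b" by auto
      then show ?thesis
      proof cases
        case 1
        have "(\<Sum>l<N. C $$ (i,l) * [:P $$ (l,k):]) = (\<Sum>l<N. C $$ (i,l) * [:f l:])"
          by (intro sum.cong refl) (use 1 k in \<open>auto simp: P_def\<close>)
        then show ?thesis using eig[OF i f] i k 1 by (simp add: B_def h_def)
      next
        case 2
        have "(\<Sum>l<N. C $$ (i,l) * [:P $$ (l,k):]) = (\<Sum>l<N. C $$ (i,l) * [:g l:])"
          by (intro sum.cong refl) (use 2 neq k in \<open>auto simp: P_def\<close>)
        then show ?thesis using eig[OF i g] i k 2 neq by (simp add: B_def h_def)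
      next
        case 3
        have "(\<Sum>l<N. C $$ (i,l) * [:P $$ (l,k):]) = (\<Sum>l<N. if l = k then C $$ (i,l) else 0)"
          by (intro sum.cong refl) (use 3 k in \<open>auto simp: P_def one_pCons\<close>)
        then show ?thesis using 3 i k by (simp add: B_def h_def)
      qed
    qed
    finally show "(C * map_mat (\<lambda>x. [:x:]) P) $$ (i,k) = (B * D) $$ (i,k)" using R by simp
  qed (use B C D P in auto)
  hence "det C * [:det P:] = det B * det D"
    using det_mult[OF C, of "map_mat (\<lambda>x. [:x:]) P"] det_mult[OF B D] P by (simp add: pc.hom_det)
  also have "det D = [:-c,1:] * [:-d,1:]"
  proof -
    have "det D = (\<Prod>i\<in>{0..<N}. h i)"
      using det_upper_triangular[OF _ D] D by (simp add: prod_list_diag_prod upper_triangular_def D_def)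
    also have "\<dots> = h a * (h b * (\<Prod>i\<in>{0..<N} - {a} - {b}. h i))"
      using ab neq prod.remove[of "{0..<N}" a h] prod.remove[of "{0..<N} - {a}" b h] by auto
    also have "(\<Prod>i\<in>{0..<N} - {a} - {b}. h i) = 1"
      by (rule prod.neutral) (auto simp: h_def)
    finally show ?thesis using neq by (simp add: h_def)
  qed
  finally have "[:-c,1:] * [:-d,1:] dvd det C * [:det P:]" by (simp only: dvd_triv_right)
  moreover have "det C * [:det P:] = Polynomial.smult (det P) (det C)" by simp
  \<comment> \<open>On a kernel vector \<open>v\<close>, rows \<open>a\<close> and \<open>b\<close>
    form a 2x2 system whose determinant is nonzero by \<open>indep\<close>, so \<open>v\<close>
    vanishes at both indices; each remaining row then forces its own coordinate to be zero.\<close>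
  moreover have "det P \<noteq> 0"
  proof
    assume "det P = 0"
    then obtain v where v: "v \<in> carrier_vec N" "v \<noteq> 0\<^sub>v N" "P *\<^sub>v v = 0\<^sub>v N"
      using det_0_iff_vec_prod_zero[OF P] by auto
    have "(\<Sum>k\<in>{0..<N}. P $$ (i,k) * vec_index v k) = 0" if "i < N" for i
      using arg_cong[OF v(3), of "\<lambda>w. vec_index w i"] that P v(1) by (auto simp: scalar_prod_def)
    moreover have "(\<Sum>k\<in>{0..<N}. P $$ (i,k) * vec_index v k)
        = f i * vec_index v a + g i * vec_index v b + (if i = a \<or> i = b then 0 else vec_index v i)"
      if "i < N" for i
    proof -
      have "(\<Sum>k\<in>{0..<N}. P $$ (i,k) * vec_index v k) =
         (\<Sum>k\<in>{0..<N}. (if k = a then f i * vec_index v k else 0) + (if k = b then g i * vec_index v k else 0)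
           + (if k = i then (if i = a \<or> i = b then 0 else vec_index v i) else 0))"
        by (intro sum.cong refl) (use that neq in \<open>auto simp: P_def\<close>)
      then show ?thesis using ab that by (simp add: sum.distrib)
    qed
    ultimately have z: "f i * vec_index v a + g i * vec_index v b + (if i = a \<or> i = b then 0 else vec_index v i) = 0"
      if "i < N" for i using that by metis
    have z1: "f a * vec_index v a + g a * vec_index v b = 0" "f b * vec_index v a + g b * vec_index v b = 0"
      using z[of a] z[of b] ab by auto
    have "(f a * g b - f b * g a) * vec_index v b
        = f a * (f b * vec_index v a + g b * vec_index v b) - f b * (f a * vec_index v a + g a * vec_index v b)"
      by (simp add: algebra_simps)
    hence vb: "vec_index v b = 0" using z1 indep by simp
    have "(f a * g b - f b * g a) * vec_index v a
        = g b * (f a * vec_index v a + g a * vec_index v b) - g a * (f b * vec_index v a + g b * vec_index v b)"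
      by (simp add: algebra_simps)
    hence va: "vec_index v a = 0" using z1 indep by simp
    have "vec_index v i = 0" if "i < N" for i
      using z[OF that] va vb by (auto split: if_splits)
    hence "v = 0\<^sub>v N" using v(1) by (intro eq_vecI) auto
    with v(2) show False by simp
  qed
  ultimately show ?thesis
    unfolding char_poly_def C_def[symmetric] by (auto dest: dvd_smult_cancel)
qed

text \<open>Otherwise sortedness leaves only the entry at index 0 as a candidate for being at most
  \<open>b\<close>, whereas \<open>a\<close> and \<open>b\<close> are two such elements counted with
  multiplicity.\<close>

lemma sorted_list_of_multiset_nth_1_le:
  fixes a b :: "'a :: linorder"
  assumes "{#a, b#} \<subseteq># M" "a \<le> b"
  shows "sorted_list_of_multiset M ! 1 \<le> b"
proof (rule ccontr)
  define xs where "xs = sorted_list_of_multiset M"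
  assume "\<not> ?thesis"
  hence gt: "xs ! 1 > b" by (simp add: xs_def)
  have s: "sorted xs" and ms: "mset xs = M" by (simp_all add: xs_def)
  have "size {#a, b#} \<le> size M" using assms(1) by (rule size_mset_mono)
  hence "length xs \<ge> 2" by (simp flip: ms)
  then obtain x y ys where xs: "xs = x # y # ys"
    by (auto simp: numeral_2_eq_2 Suc_le_length_iff)
  have "filter_mset (\<lambda>z. z \<le> b) {#a,b#} \<subseteq># filter_mset (\<lambda>z. z \<le> b) M"
    using assms(1) by (rule multiset_filter_mono)
  hence "size (filter_mset (\<lambda>z. z \<le> b) M) \<ge> 2"
    using size_mset_mono assms(2) by fastforce
  moreover have "filter_mset (\<lambda>z. z \<le> b) M \<subseteq># {#x#}"
  proof -
    have "\<forall>z\<in>set (y # ys). \<not> z \<le> b" using s gt by (auto simp: xs)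
    hence "filter (\<lambda>z. z \<le> b) (y # ys) = []" by (simp add: filter_empty_conv)
    hence "mset (filter (\<lambda>z. z \<le> b) xs) \<subseteq># {#x#}" unfolding xs filter.simps(2)[of _ x] by simp
    thus ?thesis by (simp add: mset_filter ms)
  qed
  ultimately show False using size_mset_mono by fastforce
qed

text \<open>\<open>proots\<close> counts multiplicities, so the two factors contribute two list
  entries even when \<open>c = d\<close>, as for a double eigenvalue 0.\<close>

lemma lambda_2_le:
  fixes A :: "real mat"
  assumes "A \<in> carrier_mat N N" and "[:-c, 1:] * [:-d, 1:] dvd char_poly A" "c \<le> d"
  shows "lambda_2 A \<le> d"
proof -
  obtain q where q: "char_poly A = [:-c, 1:] * [:-d, 1:] * q" using assms(2) by (auto elim: dvdE)
  have "char_poly A \<noteq> 0" using degree_monic_char_poly[OF assms(1)] by auto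
  hence "q \<noteq> 0" using q by auto
  hence "proots (char_poly A) = {#c, d#} + proots q"
    unfolding q by (subst proots_mult; (subst proots_mult)?) auto
  hence "{#c, d#} \<subseteq># proots (char_poly A)" by simp
  thus ?thesis unfolding lambda_2_def eigenvalues_sorted_def
    using sorted_list_of_multiset_nth_1_le assms(3) by blast
qed

text \<open>Vectors of length \<open>N\<close> are modelled as functions vanishing from
  \<open>N\<close> on. They then lie in a product of compact intervals and points, compact by
  Tychonoff, in which the two sum constraints are closed.\<close>

lemma compact_unit_sphere_sum_zero:
  "compact {x :: nat \<Rightarrow> real. (\<forall>i\<ge>N. x i = 0) \<and> (\<Sum>i<N. x i) = 0 \<and> (\<Sum>i<N. (x i)\<^sup>2) = 1}"
proof -
  define K where "K = PiE UNIV (\<lambda>i. if i < N then {-1..1::real} else {0})"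
  have "compactin (product_topology (\<lambda>i::nat. euclidean) UNIV) K"
    unfolding K_def by (subst compactin_PiE) (auto simp: compactin_euclidean_iff)
  hence K: "compact K" by (simp add: euclidean_product_topology compactin_euclidean_iff)
  have c: "continuous_on UNIV (\<lambda>x :: nat \<Rightarrow> real. x i)" for i by simp
  have "closed {x :: nat \<Rightarrow> real. (\<Sum>i<N. x i) = 0}" "closed {x :: nat \<Rightarrow> real. (\<Sum>i<N. (x i)\<^sup>2) = 1}"
    by (intro closed_Collect_eq continuous_intros c)+
  hence "compact (K \<inter> {x. (\<Sum>i<N. x i) = 0} \<inter> {x. (\<Sum>i<N. (x i)\<^sup>2) = 1})"
    using K by (intro compact_Int_closed)
  also have "K \<inter> {x. (\<Sum>i<N. x i) = 0} \<inter> {x. (\<Sum>i<N. (x i)\<^sup>2) = 1}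
    = {x. (\<forall>i\<ge>N. x i = 0) \<and> (\<Sum>i<N. x i) = 0 \<and> (\<Sum>i<N. (x i)\<^sup>2) = 1}"
  proof -
    have "\<bar>x i\<bar> \<le> 1" if "i < N" "(\<Sum>i<N. (x i)\<^sup>2) = 1" for x :: "nat \<Rightarrow> real" and i
    proof -
      have "(x i)\<^sup>2 \<le> (\<Sum>i<N. (x i)\<^sup>2)" using that(1) by (intro member_le_sum) auto
      thus ?thesis using that(2) by (simp add: abs_square_le_1)
    qed
    moreover have "x \<in> K \<longleftrightarrow> (\<forall>i<N. \<bar>x i\<bar> \<le> 1) \<and> (\<forall>i\<ge>N. x i = 0)" for x
    proof -
      have "x \<in> K \<longleftrightarrow> (\<forall>i. x i \<in> (if i < N then {-1..1} else {0}))" by (simp add: K_def PiE_def Pi_def)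
      also have "\<dots> \<longleftrightarrow> (\<forall>i. (i < N \<longrightarrow> \<bar>x i\<bar> \<le> 1) \<and> (i \<ge> N \<longrightarrow> x i = 0))"
        by (intro iff_allI) (auto simp: abs_le_iff)
      finally show ?thesis by blast
    qed
    ultimately show ?thesis by blast
  qed
  finally show ?thesis .
qed

text \<open>One half of the Courant-Fischer principle, without a spectral theorem. A minimizer
  \<open>w\<close> of the form on the unit sphere orthogonal to the constants is an eigenvector with
  eigenvalue \<open>\<mu>\<close>, nonnegative by \<open>psd\<close>. Together with the constant
  kernel vector it yields the two roots 0 and \<open>\<mu>\<close>, so the second smallest root is
  at most \<open>\<mu>\<close>.\<close>

lemma lambda_2_le_quadratic_form:
  fixes A :: "real mat" and x :: "nat \<Rightarrow> real"
  assumes A: "A \<in> carrier_mat N N"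
    and sym: "\<And>i k. i < N \<Longrightarrow> k < N \<Longrightarrow> A $$ (i,k) = A $$ (k,i)"
    and ker: "\<And>i. i < N \<Longrightarrow> (\<Sum>k<N. A $$ (i,k)) = 0"
    and psd: "\<And>y. 0 \<le> (\<Sum>i<N. \<Sum>k<N. A $$ (i,k) * y i * y k)"
    and x: "(\<Sum>i<N. x i) = 0"
  shows "lambda_2 A * (\<Sum>i<N. (x i)\<^sup>2) \<le> (\<Sum>i<N. \<Sum>k<N. A $$ (i,k) * x i * x k)"
proof (cases "(\<Sum>i<N. (x i)\<^sup>2) = 0")
  case True
  with psd[of x] show ?thesis by simp
next
  case False
  define Q where "Q = (\<lambda>y. \<Sum>i<N. \<Sum>k<N. A $$ (i,k) * y i * y k)"
  define n2 where "n2 = (\<lambda>y :: nat \<Rightarrow> real. \<Sum>i<N. (y i)\<^sup>2)"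
  define S where "S = {x :: nat \<Rightarrow> real. (\<forall>i\<ge>N. x i = 0) \<and> (\<Sum>i<N. x i) = 0 \<and> (\<Sum>i<N. (x i)\<^sup>2) = 1}"
  define nrm where "nrm = (\<lambda>y i. if i < N then y i / sqrt (n2 y) else 0)"
  have pos: "n2 y > 0" if "n2 y \<noteq> 0" for y
    using that unfolding n2_def by (metis less_eq_real_def sum_nonneg zero_le_power2)
  have nrm: "nrm y \<in> S" "Q (nrm y) = Q y / n2 y" if "n2 y \<noteq> 0" "(\<Sum>i<N. y i) = 0" for y
  proof -
    have "(\<Sum>i<N. nrm y i) = (\<Sum>i<N. y i) / sqrt (n2 y)"
      by (simp add: nrm_def sum_divide_distrib)
    moreover have "(\<Sum>i<N. (nrm y i)\<^sup>2) = n2 y / n2 y"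
      using pos[OF that(1)] by (simp add: nrm_def power_divide sum_divide_distrib[symmetric]) (simp add: n2_def)
    ultimately show "nrm y \<in> S" using that by (simp add: S_def nrm_def)
    have "Q (nrm y) = (\<Sum>i<N. \<Sum>k<N. A $$ (i,k) * y i * y k / n2 y)"
      unfolding Q_def using pos[OF that(1)]
      by (intro sum.cong refl) (simp add: nrm_def real_sqrt_mult_self flip: real_sqrt_mult)
    thus "Q (nrm y) = Q y / n2 y" by (simp add: Q_def sum_divide_distrib)
  qed
  have "continuous_on S Q"
    unfolding Q_def by (intro continuous_intros continuous_on_subset[OF continuous_on_product_coordinates]) auto
  moreover have "compact S" unfolding S_def by (rule compact_unit_sphere_sum_zero)
  moreover have "S \<noteq> {}" using nrm(1)[of x] False x by (auto simp: n2_def)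
  ultimately obtain w where w: "w \<in> S" "\<And>y. y \<in> S \<Longrightarrow> Q w \<le> Q y"
    by (metis continuous_attains_inf)
  define \<mu> where "\<mu> = Q w"
  have min: "\<mu> * n2 y \<le> Q y" if "(\<Sum>i<N. y i) = 0" for y
  proof (cases "n2 y = 0")
    case True
    thus ?thesis using psd[of y] by (simp add: Q_def)
  next
    case F: False
    have "\<mu> \<le> Q y / n2 y" using w(2)[OF nrm(1)] nrm(2) F that by (simp add: \<mu>_def)
    thus ?thesis using pos[OF F] by (simp add: field_simps)
  qed
  define r where "r = (\<lambda>i. (\<Sum>k<N. A $$ (i,k) * w k) - \<mu> * w i)"
  have w0: "(\<Sum>i<N. w i) = 0" and w1: "n2 w = 1" using w(1) by (auto simp: S_def n2_def)
  \<comment> \<open>The residual stays orthogonal to the constants, since by \<open>sym\<close> and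
    \<open>ker\<close> the columns of \<open>A\<close> also sum to zero. Hence \<open>min\<close>
    applies to perturbations of \<open>w\<close> along \<open>r\<close>.\<close>
  have r0: "(\<Sum>i<N. r i) = 0"
  proof -
    have "(\<Sum>i<N. \<Sum>k<N. A $$ (i,k) * w k) = (\<Sum>k<N. w k * (\<Sum>i<N. A $$ (k,i)))"
      by (subst sum.swap) (auto simp: sum_distrib_left sym intro!: sum.cong)
    also have "\<dots> = 0" using ker by simp
    finally show ?thesis using w0 by (simp add: r_def sum_subtractf flip: sum_distrib_left)
  qed
  \<comment> \<open>The minimizer is stationary: moving from w in the direction of the residual r changes
    Q - \<mu> n2 at first order by twice the squared norm of r, and that change cannot be negative
    for either sign of \<open>e\<close>.\<close>
  have quad: "0 \<le> 2 * e * n2 r + e\<^sup>2 * (Q r - \<mu> * n2 r)" for e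
  proof -
    let ?y = "\<lambda>i. w i + e * r i"
    have "(\<Sum>i<N. ?y i) = 0" using w0 r0 by (simp add: sum.distrib flip: sum_distrib_left)
    hence "\<mu> * n2 ?y \<le> Q ?y" by (rule min)
    moreover have "n2 ?y = n2 w + 2 * e * (\<Sum>i<N. w i * r i) + e\<^sup>2 * n2 r"
      unfolding n2_def by (simp add: power2_sum power_mult_distrib sum.distrib sum_distrib_left algebra_simps)
    moreover have "Q ?y = Q w + 2 * e * (\<Sum>i<N. \<Sum>k<N. A $$ (i,k) * r i * w k) + e\<^sup>2 * Q r"
    proof -
      have "(\<Sum>i<N. \<Sum>k<N. A $$ (i,k) * w i * r k) = (\<Sum>i<N. \<Sum>k<N. A $$ (i,k) * r i * w k)"
        by (subst sum.swap) (auto simp: sym intro!: sum.cong)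
      moreover have "Q ?y = Q w + e * (\<Sum>i<N. \<Sum>k<N. A $$ (i,k) * w i * r k)
          + e * (\<Sum>i<N. \<Sum>k<N. A $$ (i,k) * r i * w k) + e\<^sup>2 * Q r"
        unfolding Q_def by (simp add: sum_distrib_left sum.distrib[symmetric] power2_eq_square algebra_simps)
      ultimately show ?thesis by simp
    qed
    moreover have "(\<Sum>i<N. \<Sum>k<N. A $$ (i,k) * r i * w k) = n2 r + \<mu> * (\<Sum>i<N. w i * r i)"
    proof -
      have "(\<Sum>i<N. \<Sum>k<N. A $$ (i,k) * r i * w k) = (\<Sum>i<N. r i * (r i + \<mu> * w i))"
      proof (intro sum.cong refl)
        fix i
        have "(\<Sum>k<N. A $$ (i,k) * r i * w k) = r i * (\<Sum>k<N. A $$ (i,k) * w k)"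
          by (simp only: sum_distrib_left mult_ac)
        also have "(\<Sum>k<N. A $$ (i,k) * w k) = r i + \<mu> * w i" by (simp add: r_def)
        finally show "(\<Sum>k<N. A $$ (i,k) * r i * w k) = r i * (r i + \<mu> * w i)" .
      qed
      thus ?thesis by (simp add: n2_def power2_eq_square algebra_simps sum.distrib sum_distrib_left)
    qed
    ultimately show ?thesis using w1 by (simp add: \<mu>_def algebra_simps)
  qed
  have "n2 r = 0"
  proof (rule ccontr)
    assume "n2 r \<noteq> 0"
    hence p: "n2 r > 0" by (rule pos)
    \<comment> \<open>Any positive upper bound \<open>c\<close> on the quadratic coefficient will
      do; the step \<open>- (n2 r / c)\<close> minimizes \<open>2 * e * n2 r + e\<^sup>2 * c\<close>
      over \<open>e\<close>.\<close>
    obtain c where c: "c > 0" "Q r - \<mu> * n2 r \<le> c"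
      by (rule that[of "\<bar>Q r - \<mu> * n2 r\<bar> + 1"]) auto
    have "0 \<le> 2 * (- (n2 r / c)) * n2 r + (n2 r / c)\<^sup>2 * (Q r - \<mu> * n2 r)"
      using quad[of "- (n2 r / c)"] by simp
    also have "\<dots> \<le> 2 * (- (n2 r / c)) * n2 r + (n2 r / c)\<^sup>2 * c"
      by (intro add_left_mono mult_left_mono c) auto
    also have "\<dots> = - ((n2 r)\<^sup>2 / c)"
      using c(1) by (simp add: power2_eq_square field_simps)
    also have "\<dots> < 0" using p c(1) by simp
    finally show False by simp
  qed
  hence "r i = 0" if "i < N" for i using that by (simp add: n2_def sum_nonneg_eq_0_iff)
  hence eig: "(\<Sum>k<N. A $$ (i,k) * w k) = \<mu> * w i" if "i < N" for i using that by (simp add: r_def)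
  \<comment> \<open>Linear independence of \<open>w\<close> from the constants: a constant vector
    with zero sum is zero, contradicting unit norm. The two indices supply the nonzero 2x2
    minor.\<close>
  have "\<exists>a<N. \<exists>b<N. w a \<noteq> w b"
  proof (rule ccontr)
    assume "\<not> ?thesis"
    hence const: "w i = w 0" if "i < N" for i using that by (metis gr0I not_less_zero)
    have "(\<Sum>i<N. w i) = (\<Sum>i<N. w 0)" by (rule sum.cong[OF refl], rule const) simp
    hence "N = 0 \<or> w 0 = 0" using w0 by simp
    moreover have "n2 w = (\<Sum>i<N. (w 0)\<^sup>2)"
      unfolding n2_def using const by (metis (no_types, lifting) lessThan_iff sum.cong)
    ultimately have "n2 w = 0" by auto
    with w1 show False by simp
  qed
  then obtain a b where ab: "a < N" "b < N" "w a \<noteq> w b" by auto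
  have "[:-0, 1:] * [:-\<mu>, 1:] dvd char_poly A"
    by (rule char_poly_dvd_if_two_eigenvectors[where f = "\<lambda>_. 1" and g = w, OF A ab(1,2)])
       (use ker eig ab in auto)
  moreover have "0 \<le> \<mu>" using psd[of w] by (simp add: \<mu>_def Q_def)
  ultimately have "lambda_2 A \<le> \<mu>" using lambda_2_le[OF A] by blast
  hence "lambda_2 A * n2 x \<le> \<mu> * n2 x" by (intro mult_right_mono) (auto simp: n2_def sum_nonneg)
  also have "\<dots> \<le> Q x" using x by (rule min)
  finally show ?thesis by (simp add: n2_def Q_def)
qed

section \<open>The Laplacian of a weighted bipartite graph\<close>

lemma sum_lessThan_add:
  fixes f :: "nat \<Rightarrow> 'a :: comm_monoid_add"
  shows "(\<Sum>k<m+n. f k) = (\<Sum>i<m. f i) + (\<Sum>j<n. f (m + j))"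
  by (induction n) (simp_all add: add.assoc)

lemma laplacian_index:
  assumes "i < m" "j < n"
  shows "k < m \<Longrightarrow> laplacian m n X $$ (i, k) = (if i = k then \<Sum>j<n. X i j else 0)"
    and "l < n \<Longrightarrow> laplacian m n X $$ (m + j, m + l) = (if j = l then \<Sum>i<m. X i j else 0)"
    and "laplacian m n X $$ (i, m + j) = - X i j"
    and "laplacian m n X $$ (m + j, i) = - X i j"
  using assms by (auto simp: laplacian_def)

text \<open>The diagonal blocks supply the squares and the off-diagonal blocks the mixed terms,
  completing one square per edge. Semidefiniteness becomes visible, and only row-column differences
  enter, as in the exponents of the likelihood.\<close>

lemma laplacian_quadratic_form:
  "(\<Sum>a<m+n. \<Sum>b<m+n. laplacian m n X $$ (a,b) * x a * x b)
    = (\<Sum>i<m. \<Sum>j<n. X i j * (x i - x (m + j))\<^sup>2)"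
proof -
  have 1: "(\<Sum>b<m+n. laplacian m n X $$ (i,b) * x i * x b)
      = (\<Sum>j<n. X i j * x i * x i) - (\<Sum>j<n. X i j * x i * x (m + j))" if i: "i < m" for i
  proof -
    have "(\<Sum>k<m. laplacian m n X $$ (i,k) * x i * x k)
        = (\<Sum>k<m. if k = i then (\<Sum>j<n. X i j) * x i * x i else 0)"
      by (intro sum.cong refl) (use i in \<open>auto simp: laplacian_def\<close>)
    moreover have "(\<Sum>j<n. laplacian m n X $$ (i,m+j) * x i * x (m+j)) = - (\<Sum>j<n. X i j * x i * x (m + j))"
      using i by (simp add: laplacian_index sum_negf)
    ultimately show ?thesis using i by (simp add: sum_lessThan_add sum_distrib_right)
  qed
  have 2: "(\<Sum>b<m+n. laplacian m n X $$ (m+j,b) * x (m+j) * x b)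
      = (\<Sum>i<m. X i j * x (m+j) * x (m+j)) - (\<Sum>i<m. X i j * x i * x (m + j))" if j: "j < n" for j
  proof -
    have "(\<Sum>l<n. laplacian m n X $$ (m+j,m+l) * x (m+j) * x (m+l))
        = (\<Sum>l<n. if l = j then (\<Sum>i<m. X i j) * x (m+j) * x (m+j) else 0)"
      by (intro sum.cong refl) (use j in \<open>auto simp: laplacian_def\<close>)
    moreover have "(\<Sum>i<m. laplacian m n X $$ (m+j,i) * x (m+j) * x i) = - (\<Sum>i<m. X i j * x i * x (m + j))"
      using j by (simp add: laplacian_index sum_negf mult_ac)
    ultimately show ?thesis using j by (simp add: sum_lessThan_add sum_distrib_right)
  qed
  have "(\<Sum>a<m+n. \<Sum>b<m+n. laplacian m n X $$ (a,b) * x a * x b)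
      = (\<Sum>i<m. \<Sum>j<n. X i j * x i * x i - X i j * x i * x (m + j))
        + (\<Sum>j<n. \<Sum>i<m. X i j * x (m+j) * x (m+j) - X i j * x i * x (m + j))"
    by (subst sum_lessThan_add) (simp add: 1 2 sum_subtractf)
  also have "(\<Sum>j<n. \<Sum>i<m. X i j * x (m+j) * x (m+j) - X i j * x i * x (m + j))
      = (\<Sum>i<m. \<Sum>j<n. X i j * x (m+j) * x (m+j) - X i j * x i * x (m + j))"
    by (rule sum.swap)
  also have "(\<Sum>i<m. \<Sum>j<n. X i j * x i * x i - X i j * x i * x (m + j)) + \<dots>
      = (\<Sum>i<m. \<Sum>j<n. X i j * (x i - x (m + j))\<^sup>2)"
    unfolding sum.distrib[symmetric]
    by (intro sum.cong refl) (simp add: power2_eq_square algebra_simps)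
  finally show ?thesis .
qed

lemma lambda_2_laplacian_le:
  assumes X: "\<And>i j. 0 \<le> X i j" and z: "(\<Sum>i<m. x i) + (\<Sum>j<n. y j) = 0"
  shows "lambda_2 (laplacian m n X) * ((\<Sum>i<m. (x i)\<^sup>2) + (\<Sum>j<n. (y j)\<^sup>2))
    \<le> (\<Sum>i<m. \<Sum>j<n. X i j * (x i - y j)\<^sup>2)"
proof -
  define w where "w = (\<lambda>k. if k < m then x k else y (k - m))"
  have "lambda_2 (laplacian m n X) * (\<Sum>k<m+n. (w k)\<^sup>2)
    \<le> (\<Sum>a<m+n. \<Sum>b<m+n. laplacian m n X $$ (a,b) * w a * w b)"
  proof (rule lambda_2_le_quadratic_form)
    show "laplacian m n X \<in> carrier_mat (m+n) (m+n)" by (simp add: laplacian_def)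
    show "laplacian m n X $$ (i,k) = laplacian m n X $$ (k,i)" if "i < m+n" "k < m+n" for i k
      using that by (cases "i < m"; cases "k < m") (simp_all add: laplacian_def)
    show "(\<Sum>k<m+n. laplacian m n X $$ (a,k)) = 0" if "a < m+n" for a
    proof (cases "a < m")
      case True
      hence "(\<Sum>k<m. laplacian m n X $$ (a,k)) = (\<Sum>k<m. if k = a then \<Sum>j<n. X a j else 0)"
        by (intro sum.cong refl) (auto simp: laplacian_def)
      with True show ?thesis by (simp add: sum_lessThan_add laplacian_index sum_negf)
    next
      case False
      define j where "j = a - m"
      have j: "a = m + j" "j < n" using that False by (auto simp: j_def)
      have "(\<Sum>l<n. laplacian m n X $$ (m+j,m+l)) = (\<Sum>l<n. if l = j then \<Sum>i<m. X i j else 0)"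
        using j by (intro sum.cong refl) (auto simp: laplacian_def)
      with j show ?thesis by (simp add: sum_lessThan_add laplacian_index sum_negf)
    qed
    show "0 \<le> (\<Sum>a<m+n. \<Sum>b<m+n. laplacian m n X $$ (a,b) * u a * u b)" for u
      unfolding laplacian_quadratic_form using X by (intro sum_nonneg mult_nonneg_nonneg) auto
    show "(\<Sum>k<m+n. w k) = 0" using z by (simp add: sum_lessThan_add w_def)
  qed
  thus ?thesis unfolding laplacian_quadratic_form by (simp add: sum_lessThan_add w_def)
qed

section \<open>Error bound for the maximizer\<close>

text \<open>By convexity the difference of exponentials is at least the gap times the tangent slope
  at the smaller point, and that slope is at least \<open>exp (- b)\<close>. Symmetry in
  \<open>x\<close> and \<open>y\<close> covers both orders.\<close>

lemma exp_diff_strongly_monotone: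
  fixes x y b :: real
  assumes "\<bar>x\<bar> \<le> b" "\<bar>y\<bar> \<le> b"
  shows "exp (- b) * (x - y)\<^sup>2 \<le> (exp x - exp y) * (x - y)"
proof -
  have *: "exp (- b) * (x - y) \<le> exp x - exp y" if "y \<le> x" "\<bar>y\<bar> \<le> b" for x y
  proof -
    have "exp (- b) * (x - y) \<le> exp y * (x - y)" using that by (intro mult_right_mono) auto
    also have "\<dots> \<le> exp y * (exp (x - y) - 1)"
      using exp_ge_add_one_self[of "x - y"] by (intro mult_left_mono) (linarith, simp)
    also have "\<dots> = exp x - exp y" by (simp add: exp_diff algebra_simps)
    finally show ?thesis .
  qed
  show ?thesis
  proof (cases "y \<le> x")
    case True
    from mult_right_mono[OF *[OF True assms(2)], of "x - y"] True show ?thesis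
      by (simp add: power2_eq_square mult_ac)
  next
    case False
    hence "x \<le> y" by simp
    from mult_right_mono[OF *[OF this assms(1)], of "y - x"] False show ?thesis
      by (simp add: power2_eq_square algebra_simps)
  qed
qed

text \<open>The directional derivative vanishes at a maximizer. The direction is left arbitrary so
  that it can later be the error vector itself.\<close>

lemma is_mle_stationary:
  assumes "is_mle m n X p q u v"
  shows "(\<Sum>i<m. real (p i) * x i) - (\<Sum>j<n. real (q j) * y j)
    = (\<Sum>i<m. \<Sum>j<n. X i j * exp (u i - v j) * (x i - y j))"
proof -
  define g where "g = (\<lambda>t. loglik m n X p q (\<lambda>i. u i + t * x i) (\<lambda>j. v j + t * y j))"
  have "(g has_real_derivative (\<Sum>i<m. real (p i) * x i) - (\<Sum>j<n. real (q j) * y j)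
    - (\<Sum>i<m. \<Sum>j<n. X i j * exp (u i - v j) * (x i - y j))) (at 0)"
    unfolding g_def loglik_def
    by (auto intro!: derivative_eq_intros simp: mult_ac)
  moreover have "g t \<le> g 0" for t using assms by (simp add: g_def is_mle_def)
  ultimately show ?thesis using DERIV_local_max[of g _ 0 1] by fastforce
qed

lemma good_mle_sq_err_le:
  assumes good: "good_mle m n X us vs B p q uh vh" and X: "\<And>i j. 0 \<le> X i j"
    and lam: "0 < lambda_2 (laplacian m n X)"
  shows "sq_err m n us vs (uh, vh) \<le> exp (4 * B) / (lambda_2 (laplacian m n X))\<^sup>2
    * ((\<Sum>i<m. (real (p i) - (\<Sum>j<n. rate X us vs i j))\<^sup>2)
       + (\<Sum>j<n. (real (q j) - (\<Sum>i<m. rate X us vs i j))\<^sup>2))"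
proof -
  define x where "x = (\<lambda>i. uh i - us i)"
  define y where "y = (\<lambda>j. vh j - vs j)"
  define a where "a = (\<lambda>i. real (p i) - (\<Sum>j<n. rate X us vs i j))"
  define b where "b = (\<lambda>j. real (q j) - (\<Sum>i<m. rate X us vs i j))"
  define E where "E = (\<Sum>i<m. (x i)\<^sup>2) + (\<Sum>j<n. (y j)\<^sup>2)"
  define S where "S = (\<Sum>i<m. (a i)\<^sup>2) + (\<Sum>j<n. (b j)\<^sup>2)"
  define l where "l = lambda_2 (laplacian m n X)"
  define G where "G = (\<Sum>i<m. a i * x i) - (\<Sum>j<n. b j * y j)"
  note g = good[unfolded good_mle_def]
  have bounds: "\<bar>uh i - vh j\<bar> \<le> 2 * B" "\<bar>us i - vs j\<bar> \<le> 2 * B" if "i < m" "j < n" for i j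
  proof -
    have "\<bar>uh i\<bar> \<le> B" "\<bar>us i\<bar> \<le> B" "\<bar>vh j\<bar> \<le> B" "\<bar>vs j\<bar> \<le> B" using g that by blast+
    thus "\<bar>uh i - vh j\<bar> \<le> 2 * B" "\<bar>us i - vs j\<bar> \<le> 2 * B" by linarith+
  qed
  have rate: "rate X us vs i j = X i j * exp (us i - vs j)" for i j
    by (simp add: rate_def exp_diff exp_minus field_simps)
  \<comment> \<open>Centering subtracts from the stationarity identity the same pairing at the true
    parameters, so the weights become differences of exponentials at the estimate and at the
    truth.\<close>
  have "(\<Sum>j<n. (\<Sum>i<m. rate X us vs i j) * y j) = (\<Sum>i<m. \<Sum>j<n. rate X us vs i j * y j)"
    by (subst sum.swap) (simp add: sum_distrib_right)
  hence "G = ((\<Sum>i<m. real (p i) * x i) - (\<Sum>j<n. real (q j) * y j))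
      - (\<Sum>i<m. \<Sum>j<n. rate X us vs i j * (x i - y j))"
    by (simp add: G_def a_def b_def left_diff_distrib right_diff_distrib sum_subtractf sum_distrib_right)
  also have "\<dots> = (\<Sum>i<m. \<Sum>j<n. X i j * exp (uh i - vh j) * (x i - y j))
      - (\<Sum>i<m. \<Sum>j<n. rate X us vs i j * (x i - y j))"
    using is_mle_stationary[of m n X p q uh vh x y] g by simp
  also have "\<dots> = (\<Sum>i<m. \<Sum>j<n. X i j * ((exp (uh i - vh j) - exp (us i - vs j)) * (x i - y j)))"
    by (simp add: rate sum_subtractf[symmetric] algebra_simps)
  also have "\<dots> \<ge> (\<Sum>i<m. \<Sum>j<n. X i j * (exp (- (2 * B)) * (x i - y j)\<^sup>2))"
  proof (intro sum_mono mult_left_mono X)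
    fix i j assume "i \<in> {..<m}" "j \<in> {..<n}"
    hence "exp (- (2 * B)) * ((uh i - vh j) - (us i - vs j))\<^sup>2
      \<le> (exp (uh i - vh j) - exp (us i - vs j)) * ((uh i - vh j) - (us i - vs j))"
      by (intro exp_diff_strongly_monotone bounds) auto
    thus "exp (- (2 * B)) * (x i - y j)\<^sup>2 \<le> (exp (uh i - vh j) - exp (us i - vs j)) * (x i - y j)"
      by (simp add: x_def y_def algebra_simps)
  qed
  finally have "exp (- (2 * B)) * (\<Sum>i<m. \<Sum>j<n. X i j * (x i - y j)\<^sup>2) \<le> G"
    by (simp add: sum_distrib_left mult_ac)
  moreover have "l * E \<le> (\<Sum>i<m. \<Sum>j<n. X i j * (x i - y j)\<^sup>2)"
    unfolding l_def E_def using g by (intro lambda_2_laplacian_le X) (auto simp: x_def y_def)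
  ultimately have lower: "exp (- (2 * B)) * (l * E) \<le> G"
    by (meson exp_ge_zero mult_left_mono order_trans)
  have E0: "0 \<le> E" by (simp add: E_def sum_nonneg)
  have S0: "0 \<le> S" by (simp add: S_def sum_nonneg)
  \<comment> \<open>The column part of the pairing carries a minus sign; it is absorbed into
    \<open>- b\<close>, which leaves the squared norm \<open>S\<close> unchanged.\<close>
  have "G\<^sup>2 \<le> S * E"
  proof -
    have G: "G = (\<Sum>k<m+n. (if k < m then a k else - b (k - m)) * (if k < m then x k else y (k - m)))"
      by (simp add: G_def sum_lessThan_add sum_negf)
    have S: "S = (\<Sum>k<m+n. (if k < m then a k else - b (k - m))\<^sup>2)"
      by (simp add: S_def sum_lessThan_add)
    have E: "E = (\<Sum>k<m+n. (if k < m then x k else y (k - m))\<^sup>2)"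
      by (simp add: E_def sum_lessThan_add)
    show ?thesis unfolding G S E by (rule Cauchy_Schwarz_ineq_sum)
  qed
  moreover have "(exp (- (2 * B)) * (l * E))\<^sup>2 \<le> G\<^sup>2"
    using lower E0 lam by (intro power_mono) (auto simp: l_def)
  ultimately have "(exp (- (2 * B)) * (l * E))\<^sup>2 \<le> S * E" by linarith
  moreover have "(exp (- (2 * B)))\<^sup>2 = exp (- (4 * B))" by (simp add: exp_double[symmetric])
  ultimately have "exp (- (4 * B)) * l\<^sup>2 * E * E \<le> S * E"
    by (simp add: power_mult_distrib power2_eq_square mult_ac)
  \<comment> \<open>One factor \<open>E\<close> is cancelled; for \<open>E = 0\<close> the claim is
    just \<open>0 \<le> S\<close>.\<close>
  hence "exp (- (4 * B)) * l\<^sup>2 * E \<le> S"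
    using E0 S0 by (cases "E = 0") (auto simp: mult_le_cancel_right)
  hence "E \<le> exp (4 * B) / l\<^sup>2 * S"
    using lam by (simp add: l_def exp_minus field_simps)
  thus ?thesis by (simp add: E_def S_def sq_err_def l_def x_def y_def a_def b_def)
qed

section \<open>Squares of centered Poisson variables\<close>

text \<open>The exponential is the moment generating function of a Poisson variable of mean
  \<open>a\<close> minus its mean. Stating it by \<open>has_bochner_integral\<close> includes
  integrability, and \<open>a = 0\<close> covers the cells that are constantly zero.\<close>

definition centered_poisson_mgf :: "'a pmf \<Rightarrow> ('a \<Rightarrow> real) \<Rightarrow> real \<Rightarrow> bool" where
  "centered_poisson_mgf M Z a \<longleftrightarrow>
     (\<forall>t. has_bochner_integral (measure_pmf M) (\<lambda>\<omega>. exp (t * Z \<omega>)) (exp (a * (exp t - 1 - t))))"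

lemma centered_poisson_mgf_poisson_pmf:
  assumes r: "0 < r"
  shows "centered_poisson_mgf (poisson_pmf r) (\<lambda>k. real k - r) r"
  unfolding centered_poisson_mgf_def
proof
  fix t
  have r': "0 < r * exp t" using r by simp
  \<comment> \<open>Exponential tilting turns the Poisson(r) density into a multiple of the Poisson(r e^t) density.\<close>
  have tilt: "pmf (poisson_pmf r) k * exp (t * (real k - r))
      = exp (r * (exp t - 1 - t)) * pmf (poisson_pmf (r * exp t)) k" for k
    using r r' by (simp add: power_mult_distrib exp_of_nat_mult[symmetric] mult_exp_exp algebra_simps
        flip: exp_add)
  have "(\<integral>\<^sup>+ k. ennreal (exp (t * (real k - r))) \<partial>measure_pmf (poisson_pmf r))
      = (\<integral>\<^sup>+ k. ennreal (exp (r * (exp t - 1 - t))) * ennreal (pmf (poisson_pmf (r * exp t)) k) \<partial>count_space UNIV)"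
    by (simp add: nn_integral_measure_pmf tilt flip: ennreal_mult)
  also have "\<dots> = ennreal (exp (r * (exp t - 1 - t)))"
    by (simp add: nn_integral_cmult nn_integral_pmf_eq_1)
  finally show "has_bochner_integral (measure_pmf (poisson_pmf r)) (\<lambda>k. exp (t * (real k - r)))
      (exp (r * (exp t - 1 - t)))"
    by (intro has_bochner_integral_nn_integral) auto
qed

lemma centered_poisson_mgf_sum_Pi_pmf:
  fixes p :: "'i \<Rightarrow> 'b pmf"
  assumes I: "finite I" "K \<subseteq> I"
    and p: "\<And>k. k \<in> K \<Longrightarrow> centered_poisson_mgf (p k) (Z k) (r k)"
  shows "centered_poisson_mgf (Pi_pmf I d p) (\<lambda>f. \<Sum>k\<in>K. Z k (f k)) (\<Sum>k\<in>K. r k)"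
  unfolding centered_poisson_mgf_def
proof
  fix t
  \<comment> \<open>Padding with factors 1 outside \<open>K\<close> lets the product formula over
    all of \<open>I\<close> compute the transform of a block sum.\<close>
  define g where "g = (\<lambda>k y. if k \<in> K then exp (t * Z k y) else 1)"
  have K: "finite K" using I by (rule rev_finite_subset)
  have int: "has_bochner_integral (measure_pmf (p k)) (g k) (if k \<in> K then exp (r k * (exp t - 1 - t)) else 1)" for k
    using p[of k] by (auto simp: g_def centered_poisson_mgf_def has_bochner_integral_iff)
  have prod: "(\<Prod>k\<in>I. if k \<in> K then h k else 1) = (\<Prod>k\<in>K. h k)" for h :: "'i \<Rightarrow> real"
    using I prod.inter_restrict[of I h K] by (simp add: Int_absorb1)
  have eq: "(\<lambda>f. exp (t * (\<Sum>k\<in>K. Z k (f k)))) = (\<lambda>f. \<Prod>k\<in>I. g k (f k))"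
    by (simp add: g_def prod exp_sum[OF K] sum_distrib_left)
  have "integrable (measure_pmf (Pi_pmf I d p)) (\<lambda>f. \<Prod>k\<in>I. g k (f k))"
    using int by (intro integrable_prod_Pi_pmf I) (auto dest: integrable.intros)
  moreover have "measure_pmf.expectation (Pi_pmf I d p) (\<lambda>f. \<Prod>k\<in>I. g k (f k))
      = (\<Prod>k\<in>I. measure_pmf.expectation (p k) (g k))"
    using int by (intro expectation_prod_Pi_pmf I) (auto dest: integrable.intros simp: g_def)
  moreover have "\<dots> = exp ((\<Sum>k\<in>K. r k) * (exp t - 1 - t))"
    using int by (simp add: has_bochner_integral_integral_eq[OF int] prod sum_distrib_right exp_sum[OF K])
  ultimately show "has_bochner_integral (measure_pmf (Pi_pmf I d p)) (\<lambda>f. exp (t * (\<Sum>k\<in>K. Z k (f k))))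
      (exp ((\<Sum>k\<in>K. r k) * (exp t - 1 - t)))"
    by (simp add: eq has_bochner_integral_iff)
qed

section \<open>Exponential inequalities and exponential moments of squares\<close>

lemma exp_le_quadratic:
  fixes x :: real
  assumes "\<bar>x\<bar> \<le> 1"
  shows "exp x \<le> 1 + x + x\<^sup>2"
proof (cases "0 \<le> x")
  case True
  then show ?thesis using exp_bound assms by simp
next
  case False
  define w where "w = - x"
  have w: "0 < w" "w \<le> 1" using False assms by (auto simp: w_def)
  have "exp x = 1 / exp w" by (simp add: w_def exp_minus field_simps)
  also have "\<dots> \<le> 1 / (1 + w)" using w exp_ge_add_one_self[of w] by (intro divide_left_mono) auto
  also have "\<dots> \<le> 1 - w + w\<^sup>2"
  proof -
    have "(1 - w + w\<^sup>2) * (1 + w) = 1 + w ^ 3" by (simp add: algebra_simps power2_eq_square power3_eq_cube)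
    thus ?thesis using w by (simp add: divide_le_eq)
  qed
  finally show ?thesis by (simp add: w_def)
qed

text \<open>The right-hand side is the square of 2 sinh(x/2), and |sinh y| is at least |y|.\<close>

lemma square_le_exp_plus_exp_minus:
  fixes x :: real
  shows "x\<^sup>2 \<le> exp x + exp (-x) - 2"
proof -
  have "\<bar>x / 2\<bar> \<le> \<bar>(exp (x/2) - exp (-(x/2))) / 2\<bar>"
    using real_le_abs_sinh[of "x / 2"] by (simp only: exp_minus)
  hence "\<bar>x\<bar> \<le> \<bar>exp (x/2) - exp (-(x/2))\<bar>" by simp
  hence "x\<^sup>2 \<le> (exp (x/2) - exp (-(x/2)))\<^sup>2" by (simp only: abs_le_square_iff)
  also have "\<dots> = exp x + exp (-x) - 2"
    by (simp add: power2_diff flip: exp_double exp_add)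
  finally show ?thesis .
qed

text \<open>The majorant is a combination of exponentials, so its expectation is known from the
  generating function. It is the product of the bounds 2 cosh y - 2 for the square and 2 cosh y for
  the exponential, at \<open>y = t * x\<close>.\<close>

lemma square_mult_exp_abs_le:
  fixes x t :: real
  assumes "0 < t"
  shows "x\<^sup>2 * exp (t * \<bar>x\<bar>)
    \<le> (exp (2*t*x) + exp (-(2*t)*x) + 2 - 2 * exp (t*x) - 2 * exp (-t*x)) / t\<^sup>2"
proof -
  define y where "y = t * x"
  have "t\<^sup>2 * (x\<^sup>2 * exp (t * \<bar>x\<bar>)) = y\<^sup>2 * exp \<bar>y\<bar>"
    using assms by (simp add: y_def power_mult_distrib abs_mult mult_ac)
  also have "\<dots> \<le> (exp y + exp (-y) - 2) * (exp y + exp (-y))"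
  proof (intro mult_mono)
    show "exp \<bar>y\<bar> \<le> exp y + exp (-y)" by (cases "0 \<le> y") auto
    show "0 \<le> exp y + exp (-y) - 2" using square_le_exp_plus_exp_minus[of y] zero_le_power2[of y] by linarith
  qed (auto simp: square_le_exp_plus_exp_minus)
  also have "\<dots> = exp (2*y) + exp (-(2*y)) + 2 - 2 * exp y - 2 * exp (-y)"
  proof -
    have "exp (2*y) = exp y * exp y" "exp (-(2*y)) = exp (-y) * exp (-y)" "exp y * exp (-y) = 1"
      by (simp_all flip: exp_add)
    thus ?thesis by (simp add: algebra_simps)
  qed
  finally have "t\<^sup>2 * (x\<^sup>2 * exp (t * \<bar>x\<bar>))
      \<le> exp (2*t*x) + exp (-(2*t)*x) + 2 - 2 * exp (t*x) - 2 * exp (-t*x)"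
    by (simp add: y_def mult.assoc)
  thus ?thesis using assms by (simp add: field_simps)
qed

text \<open>The constant terms cancel, so only terms proportional to \<open>a\<close> remain. The
  values at 2t and -2t are bounded above, those at t and -t below; the net coefficient 17/16 *
  289/64 - 2 is less than 4.\<close>

lemma poisson_mgf_second_difference_le:
  fixes a t :: real
  defines "\<phi> \<equiv> \<lambda>t. exp (a * (exp t - 1 - t))"
  assumes t: "0 < t" "t \<le> 1/8" and a: "0 \<le> a" "a * t\<^sup>2 \<le> 1/64"
  shows "\<phi> (2*t) + \<phi> (-(2*t)) + 2 - 2 * \<phi> t - 2 * \<phi> (-t) \<le> 4 * a * t\<^sup>2"
proof -
  define \<psi> :: "real \<Rightarrow> real" where "\<psi> = (\<lambda>t. exp t - 1 - t)"
  have \<psi>0: "0 \<le> \<psi> u" for u using exp_ge_add_one_self[of u] unfolding \<psi>_def by linarith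
  \<comment> \<open>Here \<open>\<psi> u\<close> is at most \<open>4 * t\<^sup>2\<close>, so
    \<open>y = a * \<psi> u\<close> is at most 1/16, where 1 + y + y^2 is at most 1 + (17/16)
    y.\<close>
  have up: "\<phi> u \<le> 1 + 17/16 * (a * \<psi> u)" if u: "\<bar>u\<bar> = 2 * t" for u
  proof -
    have "\<psi> u \<le> u\<^sup>2" using exp_le_quadratic[of u] u t by (simp add: \<psi>_def)
    also have "u\<^sup>2 = (2 * t)\<^sup>2" using u by (metis power2_abs)
    also have "\<dots> = 4 * t\<^sup>2" by (simp add: power_mult_distrib)
    finally have "a * \<psi> u \<le> a * (4 * t\<^sup>2)" using a by (intro mult_left_mono)
    hence y: "a * \<psi> u \<le> 1/16" using a(2) by simp
    have y0: "0 \<le> a * \<psi> u" using a \<psi>0 by simp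
    have "\<phi> u \<le> 1 + a * \<psi> u + (a * \<psi> u)\<^sup>2"
      unfolding \<phi>_def \<psi>_def[symmetric] using y y0 by (simp add: \<psi>_def exp_bound)
    also have "(a * \<psi> u)\<^sup>2 \<le> 1/16 * (a * \<psi> u)"
      unfolding power2_eq_square using y y0 by (intro mult_right_mono)
    finally show ?thesis by simp
  qed
  have low: "1 + a * \<psi> u \<le> \<phi> u" for u
    using exp_ge_add_one_self[of "a * \<psi> u"] by (simp add: \<phi>_def \<psi>_def)
  have s1: "t\<^sup>2 \<le> \<psi> t + \<psi> (-t)" using square_le_exp_plus_exp_minus[of t] by (simp add: \<psi>_def)
  have s2: "\<psi> (2*t) + \<psi> (-(2*t)) \<le> 289/64 * t\<^sup>2"
  proof -
    have "\<psi> (2*t) + \<psi> (-(2*t)) = (exp t - exp (-t))\<^sup>2"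
    proof -
      have "exp (2*t) = exp t * exp t" "exp (-(2*t)) = exp (-t) * exp (-t)" "exp t * exp (-t) = 1"
        by (simp_all flip: exp_add)
      thus ?thesis by (simp add: \<psi>_def power2_eq_square algebra_simps)
    qed
    \<comment> \<open>The difference is at most 2t + t^2, and t^2 is at most t/8.\<close>
    also have "\<dots> \<le> (17/8 * t)\<^sup>2"
    proof (intro power_mono)
      have "exp t \<le> 1 + t + t\<^sup>2" using t by (intro exp_bound) auto
      moreover have "1 - t \<le> exp (-t)" using exp_ge_add_one_self[of "-t"] by simp
      moreover have "t\<^sup>2 \<le> 1/8 * t" unfolding power2_eq_square using t by (intro mult_right_mono) auto
      ultimately show "exp t - exp (-t) \<le> 17/8 * t" by simp
      show "0 \<le> exp t - exp (-t)" using t by simp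
    qed
    finally show ?thesis by (simp add: power_mult_distrib power_divide)
  qed
  have "a * \<psi> (2*t) + a * \<psi> (-(2*t)) \<le> 289/64 * (a * t\<^sup>2)"
    using mult_left_mono[OF s2 a(1)] by (simp add: algebra_simps)
  moreover have "a * t\<^sup>2 \<le> a * \<psi> t + a * \<psi> (-t)"
    using mult_left_mono[OF s1 a(1)] by (simp add: algebra_simps)
  moreover have "0 \<le> a * t\<^sup>2" using a by simp
  ultimately show ?thesis
    using up[of "2*t"] up[of "-(2*t)"] low[of t] low[of "-t"] t by simp
qed

lemma centered_poisson_mgf_square_exp_moment:
  assumes M: "centered_poisson_mgf M Z a"
    and t: "0 < t" "t \<le> 1/8" and a: "0 \<le> a" "a * t\<^sup>2 \<le> 1/64"
  shows "integrable (measure_pmf M) (\<lambda>\<omega>. (Z \<omega>)\<^sup>2 * exp (t * \<bar>Z \<omega>\<bar>))"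
    and "measure_pmf.expectation M (\<lambda>\<omega>. (Z \<omega>)\<^sup>2 * exp (t * \<bar>Z \<omega>\<bar>)) \<le> 4 * a"
proof -
  define h where "h = (\<lambda>x. (exp (2*t*x) + exp (-(2*t)*x) + 2 - 2 * exp (t*x) - 2 * exp (-t*x)) / t\<^sup>2)"
  define \<phi> where "\<phi> = (\<lambda>t. exp (a * (exp t - 1 - t)))"
  have \<phi>: "has_bochner_integral (measure_pmf M) (\<lambda>\<omega>. exp (s * Z \<omega>)) (\<phi> s)" for s
    using M by (simp add: centered_poisson_mgf_def \<phi>_def)
  have "has_bochner_integral (measure_pmf M) (\<lambda>_. 2::real) 2"
    by (simp add: has_bochner_integral_iff)
  hence H: "has_bochner_integral (measure_pmf M) (\<lambda>\<omega>. h (Z \<omega>))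
      ((\<phi> (2*t) + \<phi> (-(2*t)) + 2 - 2 * \<phi> t - 2 * \<phi> (-t)) / t\<^sup>2)"
    unfolding h_def
    by (intro has_bochner_integral_divide has_bochner_integral_diff has_bochner_integral_add
        has_bochner_integral_mult_right \<phi>)
  have le: "(Z \<omega>)\<^sup>2 * exp (t * \<bar>Z \<omega>\<bar>) \<le> h (Z \<omega>)" for \<omega>
    unfolding h_def by (rule square_mult_exp_abs_le) (rule t)
  show int: "integrable (measure_pmf M) (\<lambda>\<omega>. (Z \<omega>)\<^sup>2 * exp (t * \<bar>Z \<omega>\<bar>))"
    by (rule Bochner_Integration.integrable_bound[OF integrable.intros[OF H]])
       (auto intro!: AE_I2 order_trans[OF le])
  have "measure_pmf.expectation M (\<lambda>\<omega>. (Z \<omega>)\<^sup>2 * exp (t * \<bar>Z \<omega>\<bar>))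
      \<le> measure_pmf.expectation M (\<lambda>\<omega>. h (Z \<omega>))"
    by (intro integral_mono int integrable.intros[OF H] le)
  also have "\<dots> = (\<phi> (2*t) + \<phi> (-(2*t)) + 2 - 2 * \<phi> t - 2 * \<phi> (-t)) / t\<^sup>2"
    using H by (rule has_bochner_integral_integral_eq)
  also have "\<dots> \<le> 4 * a * t\<^sup>2 / t\<^sup>2"
    unfolding \<phi>_def by (intro divide_right_mono poisson_mgf_second_difference_le t a) auto
  finally show "measure_pmf.expectation M (\<lambda>\<omega>. (Z \<omega>)\<^sup>2 * exp (t * \<bar>Z \<omega>\<bar>)) \<le> 4 * a" using t by simp
qed

text \<open>Markov's inequality for \<open>exp (t * Z \<omega>) + exp (- t * Z \<omega>)\<close>,
  which dominates \<open>exp (t * \<bar>Z \<omega>\<bar>)\<close>. Each summand has expectation at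
  most exp(1/64), hence at most 3/2, which gives the factor 3.\<close>

lemma centered_poisson_mgf_tail:
  assumes M: "centered_poisson_mgf M Z a"
    and t: "0 < t" "t \<le> 1/8" and a: "0 \<le> a" "a * t\<^sup>2 \<le> 1/64"
  shows "measure_pmf.prob M {\<omega>. T < \<bar>Z \<omega>\<bar>} \<le> 3 * exp (- (t * T))"
proof -
  define \<phi> where "\<phi> = (\<lambda>t. exp (a * (exp t - 1 - t)))"
  have H: "has_bochner_integral (measure_pmf M) (\<lambda>\<omega>. exp (t * Z \<omega>) + exp (- t * Z \<omega>)) (\<phi> t + \<phi> (-t))"
    using M by (intro has_bochner_integral_add) (simp_all only: centered_poisson_mgf_def \<phi>_def)
  have \<phi>: "\<phi> s \<le> 3/2" if "\<bar>s\<bar> = t" for s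
  proof -
    have "a * (exp s - 1 - s) \<le> a * s\<^sup>2"
      using exp_le_quadratic[of s] that t a by (intro mult_left_mono) auto
    also have "s\<^sup>2 = t\<^sup>2" using that by (metis power2_abs)
    finally have "a * (exp s - 1 - s) \<le> 1/64" using a by simp
    hence "\<phi> s \<le> exp (1/64)" by (simp add: \<phi>_def)
    also have "\<dots> \<le> 3/2" using exp_le_quadratic[of "1/64"] by (simp add: power2_eq_square)
    finally show ?thesis .
  qed
  have "measure_pmf.prob M {\<omega>. T < \<bar>Z \<omega>\<bar>}
      \<le> measure_pmf.prob M {\<omega>\<in>space (measure_pmf M). exp (t * Z \<omega>) + exp (- t * Z \<omega>) \<ge> exp (t * T)}"
  proof (intro measure_pmf.finite_measure_mono subsetI)
    fix \<omega> assume "\<omega> \<in> {\<omega>. T < \<bar>Z \<omega>\<bar>}"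
    hence "t * T \<le> t * \<bar>Z \<omega>\<bar>" using t by simp
    hence "exp (t * T) \<le> exp (t * \<bar>Z \<omega>\<bar>)" by simp
    also have "\<dots> \<le> exp (t * Z \<omega>) + exp (- t * Z \<omega>)" by (cases "0 \<le> Z \<omega>") auto
    finally show "\<omega> \<in> {\<omega>\<in>space (measure_pmf M). exp (t * Z \<omega>) + exp (- t * Z \<omega>) \<ge> exp (t * T)}" by simp
  qed auto
  also have "\<dots> \<le> measure_pmf.expectation M (\<lambda>\<omega>. exp (t * Z \<omega>) + exp (- t * Z \<omega>)) / exp (t * T)"
    by (rule integral_Markov_inequality_measure[OF integrable.intros[OF H], of "{}"])
       (auto intro!: AE_I2 add_nonneg_nonneg)
  also have "measure_pmf.expectation M (\<lambda>\<omega>. exp (t * Z \<omega>) + exp (- t * Z \<omega>)) = \<phi> t + \<phi> (-t)"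
    using H by (rule has_bochner_integral_integral_eq)
  also have "(\<phi> t + \<phi> (-t)) / exp (t * T) \<le> 3 / exp (t * T)"
    using \<phi>[of t] \<phi>[of "-t"] t by (intro divide_right_mono) auto
  finally show ?thesis by (simp add: exp_minus field_simps)
qed

text \<open>On the truncation event the exponent \<open>t / T * Z\<^sup>2\<close> is at most linear in \<open>\<bar>Z\<bar>\<close>, so the
  square has an exponential moment although \<open>Z\<^sup>2\<close> itself has none.\<close>
lemma centered_poisson_mgf_truncated_square:
  fixes Z :: "'a \<Rightarrow> real" and T :: real
  defines "W \<equiv> \<lambda>\<omega>. if \<bar>Z \<omega>\<bar> \<le> T then (Z \<omega>)\<^sup>2 else 0"
  assumes M: "centered_poisson_mgf M Z a"
    and t: "0 < t" "t \<le> 1/8" and a: "0 \<le> a" "a * t\<^sup>2 \<le> 1/64" and T: "0 < T"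
  shows "integrable (measure_pmf M) (\<lambda>\<omega>. exp (t / T * W \<omega>))"
    and "measure_pmf.expectation M (\<lambda>\<omega>. exp (t / T * W \<omega>)) \<le> exp (4 * (t / T) * a)"
proof -
  note S = centered_poisson_mgf_square_exp_moment[OF M t a]
  define h where "h = (\<lambda>\<omega>. 1 + t / T * ((Z \<omega>)\<^sup>2 * exp (t * \<bar>Z \<omega>\<bar>)))"
  have le: "exp (t / T * W \<omega>) \<le> h \<omega>" for \<omega>
  proof (cases "\<bar>Z \<omega>\<bar> \<le> T")
    case True
    define y where "y = t / T * (Z \<omega>)\<^sup>2"
    have "y = t / T * (\<bar>Z \<omega>\<bar> * \<bar>Z \<omega>\<bar>)" by (simp add: y_def power2_eq_square)
    also have "\<dots> \<le> t / T * (T * \<bar>Z \<omega>\<bar>)"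
      using True t T by (intro mult_left_mono mult_right_mono) auto
    finally have y: "y \<le> t * \<bar>Z \<omega>\<bar>" using T by simp
    have y0: "0 \<le> y" using t T by (simp add: y_def)
    \<comment> \<open>The resulting bound 1 + y exp y keeps the factor y, so the excess over 1 is
      controlled by the weighted second moment and hence is proportional to
      \<open>a\<close>.\<close>
    have "exp y * (1 - y) \<le> exp y * exp (- y)"
      using exp_ge_add_one_self[of "-y"] by (intro mult_left_mono) (linarith, simp)
    hence "exp y \<le> 1 + y * exp y" by (simp add: algebra_simps flip: exp_add)
    also have "y * exp y \<le> y * exp (t * \<bar>Z \<omega>\<bar>)" using y y0 by (intro mult_left_mono) auto
    finally show ?thesis using True by (simp add: W_def h_def y_def mult.assoc)
  next
    case False
    thus ?thesis using t T by (simp add: W_def h_def)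
  qed
  have h: "integrable (measure_pmf M) h"
    unfolding h_def using S(1) by simp
  show int: "integrable (measure_pmf M) (\<lambda>\<omega>. exp (t / T * W \<omega>))"
  proof (rule Bochner_Integration.integrable_bound[OF h])
    have "norm (exp (t / T * W \<omega>)) \<le> norm (h \<omega>)" for \<omega>
      using order_trans[OF le[of \<omega>] abs_ge_self] by simp
    thus "AE \<omega> in measure_pmf M. norm (exp (t / T * W \<omega>)) \<le> norm (h \<omega>)" by simp
  qed simp
  have "measure_pmf.expectation M (\<lambda>\<omega>. exp (t / T * W \<omega>)) \<le> measure_pmf.expectation M h"
    by (intro integral_mono int h le)
  also have "\<dots> = 1 + t / T * measure_pmf.expectation M (\<lambda>\<omega>. (Z \<omega>)\<^sup>2 * exp (t * \<bar>Z \<omega>\<bar>))"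
    unfolding h_def using S(1) by simp
  also have "\<dots> \<le> 1 + t / T * (4 * a)" using S(2) t T by (intro add_left_mono mult_left_mono) auto
  also have "\<dots> \<le> exp (t / T * (4 * a))" by (rule exp_ge_add_one_self)
  finally show "measure_pmf.expectation M (\<lambda>\<omega>. exp (t / T * W \<omega>)) \<le> exp (4 * (t / T) * a)"
    by (simp add: mult_ac)
qed

section \<open>Sums of squares over independent blocks\<close>

lemma (in prob_space) indep_vars_sum_blocks:
  fixes Z :: "'i \<Rightarrow> 'b \<Rightarrow> real"
  assumes "indep_vars (\<lambda>_. count_space UNIV) (\<lambda>k \<omega>. X k \<omega>) I"
    and "\<And>l. l \<in> L \<Longrightarrow> K l \<subseteq> I" and "disjoint_family_on K L"
  shows "indep_vars (\<lambda>_. borel) (\<lambda>l \<omega>. \<Sum>k\<in>K l. Z k (X k \<omega>)) L"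
proof -
  have "indep_vars (\<lambda>_. borel) (\<lambda>l \<omega>. \<Sum>k\<in>K l. Z k (restrict (\<lambda>k. X k \<omega>) (K l) k)) L"
  proof (rule indep_vars_compose2[OF indep_vars_restrict[OF assms], where Y = "\<lambda>l f. \<Sum>k\<in>K l. Z k (f k)"])
    fix l assume "l \<in> L"
    show "(\<lambda>f. \<Sum>k\<in>K l. Z k (f k)) \<in> borel_measurable (PiM (K l) (\<lambda>_. count_space UNIV))"
    proof (rule borel_measurable_sum)
      fix k assume "k \<in> K l"
      thus "(\<lambda>f. Z k (f k)) \<in> borel_measurable (PiM (K l) (\<lambda>_. count_space UNIV))"
        by (intro measurable_compose[OF measurable_component_singleton]) auto
    qed
  qed
  thus ?thesis by (simp cong: sum.cong)
qed

lemma centered_poisson_sum_squares_expectation: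
  assumes M: "\<And>l. l \<in> L \<Longrightarrow> centered_poisson_mgf M (Z l) (a l)" and a: "\<And>l. l \<in> L \<Longrightarrow> 0 \<le> a l"
  shows "integrable (measure_pmf M) (\<lambda>\<omega>. \<Sum>l\<in>L. (Z l \<omega>)\<^sup>2)"
    and "measure_pmf.expectation M (\<lambda>\<omega>. \<Sum>l\<in>L. (Z l \<omega>)\<^sup>2) \<le> 4 * (\<Sum>l\<in>L. a l)"
proof -
  have *: "integrable (measure_pmf M) (\<lambda>\<omega>. (Z l \<omega>)\<^sup>2) \<and> measure_pmf.expectation M (\<lambda>\<omega>. (Z l \<omega>)\<^sup>2) \<le> 4 * a l"
    if l: "l \<in> L" for l
  proof -
    \<comment> \<open>This choice keeps both \<open>t\<close> and \<open>a l * t\<close> at most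
      1/8, so the weighted moment bound applies; its exponential weight is at least 1 and is then
      dropped.\<close>
    define t where "t = 1 / (8 * (1 + a l))"
    have al: "0 \<le> a l" using a l by blast
    have t: "0 < t" "t \<le> 1/8" using al by (simp_all add: t_def field_simps)
    have "a l * t\<^sup>2 = (a l * t) * t" by (simp add: power2_eq_square)
    also have "\<dots> \<le> 1/8 * (1/8)"
      using t al by (intro mult_mono) (simp_all add: t_def field_simps)
    finally have at: "a l * t\<^sup>2 \<le> 1/64" by simp
    note S = centered_poisson_mgf_square_exp_moment[OF M[OF l] t al at]
    have le: "(Z l \<omega>)\<^sup>2 \<le> (Z l \<omega>)\<^sup>2 * exp (t * \<bar>Z l \<omega>\<bar>)" for \<omega>
      using t by (simp add: mult_le_cancel_left1)
    have int: "integrable (measure_pmf M) (\<lambda>\<omega>. (Z l \<omega>)\<^sup>2)"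
      by (rule Bochner_Integration.integrable_bound[OF S(1)]) (auto intro!: AE_I2 simp: le)
    moreover have "measure_pmf.expectation M (\<lambda>\<omega>. (Z l \<omega>)\<^sup>2) \<le> 4 * a l"
      using integral_mono[OF int S(1) le] S(2) by linarith
    ultimately show ?thesis ..
  qed
  show "integrable (measure_pmf M) (\<lambda>\<omega>. \<Sum>l\<in>L. (Z l \<omega>)\<^sup>2)" using * by simp
  have "measure_pmf.expectation M (\<lambda>\<omega>. \<Sum>l\<in>L. (Z l \<omega>)\<^sup>2)
      = (\<Sum>l\<in>L. measure_pmf.expectation M (\<lambda>\<omega>. (Z l \<omega>)\<^sup>2))"
    using * by (intro Bochner_Integration.integral_sum) simp
  also have "\<dots> \<le> 4 * (\<Sum>l\<in>L. a l)"
    unfolding sum_distrib_left using * by (intro sum_mono) simp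
  finally show "measure_pmf.expectation M (\<lambda>\<omega>. \<Sum>l\<in>L. (Z l \<omega>)\<^sup>2) \<le> 4 * (\<Sum>l\<in>L. a l)" .
qed

text \<open>Two failure events share the budget equally: some variable exceeds the truncation level
  (union bound), or the truncated sum is large (Chernoff, where independence factorizes the
  expectation). Off the first event the truncated and true sums agree.\<close>

lemma centered_poisson_sum_squares_tail:
  fixes A \<delta> :: real
  assumes M: "\<And>l. l \<in> L \<Longrightarrow> centered_poisson_mgf M (Z l) (a l)"
    and indep: "prob_space.indep_vars (measure_pmf M) (\<lambda>_. borel) Z L"
    and L: "finite L" "L \<noteq> {}"
    and a: "\<And>l. l \<in> L \<Longrightarrow> 0 \<le> a l" "\<And>l. l \<in> L \<Longrightarrow> a l \<le> A"
    and \<delta>: "0 < \<delta>" "\<delta> < 1"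
  shows "measure_pmf.prob M {\<omega>. 4 * (\<Sum>l\<in>L. a l) + 64 * (1 + A) * ln (4 / \<delta>) * ln (12 * real (card L) / \<delta>)
      < (\<Sum>l\<in>L. (Z l \<omega>)\<^sup>2)} \<le> \<delta> / 2"
proof -
  have A0: "0 \<le> A" using a L by (meson all_not_in_conv order_trans)
  define N where "N = real (card L)"
  have N: "1 \<le> N" using L by (simp add: N_def Suc_leI card_gt_0_iff)
  \<comment> \<open>Chosen so that \<open>t\<^sup>2 * (1 + A)\<close> equals 1/64, uniformly over
    the index set.\<close>
  define t where "t = 1 / (8 * sqrt (1 + A))"
  have t: "0 < t" "t \<le> 1/8" using A0 by (simp_all add: t_def field_simps)
  have t2: "t\<^sup>2 = 1 / (64 * (1 + A))" using A0 by (simp add: t_def power_divide power_mult_distrib)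
  have at: "a l * t\<^sup>2 \<le> 1/64" if "l \<in> L" for l
    using a(2)[OF that] A0 by (simp add: t2 field_simps)
  \<comment> \<open>The level \<open>T = H / t\<close> is dictated by the union bound:
    \<open>3 * N * exp (- H)\<close> must equal \<open>\<delta> / 4\<close>.\<close>
  define H where "H = ln (12 * N / \<delta>)"
  have H: "0 < H" using N \<delta> unfolding H_def by (intro ln_gt_zero) (simp add: field_simps)
  define T where "T = H / t"
  have T: "0 < T" using H t by (simp add: T_def)
  define W where "W = (\<lambda>l \<omega>. if \<bar>Z l \<omega>\<bar> \<le> T then (Z l \<omega>)\<^sup>2 else 0)"
  define s where "s = t / T"
  have s: "0 < s" using t T by (simp add: s_def)
  define \<kappa> where "\<kappa> = (\<Sum>l\<in>L. a l)"
  have thr: "64 * (1 + A) * ln (4 / \<delta>) * H = ln (4 / \<delta>) / s"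
  proof -
    have "s = t\<^sup>2 / H" using t by (simp add: s_def T_def power2_eq_square)
    thus ?thesis using H A0 by (simp add: t2)
  qed
  define E1 where "E1 = (\<Union>l\<in>L. {\<omega>. T < \<bar>Z l \<omega>\<bar>})"
  define E2 where "E2 = {\<omega>\<in>space (measure_pmf M). (\<Prod>l\<in>L. exp (s * W l \<omega>)) \<ge> exp (4 * s * \<kappa>) * (4 / \<delta>)}"
  have "measure_pmf.prob M E1 \<le> (\<Sum>l\<in>L. measure_pmf.prob M {\<omega>. T < \<bar>Z l \<omega>\<bar>})"
    unfolding E1_def using L by (intro measure_pmf.finite_measure_subadditive_finite) auto
  also have "\<dots> \<le> (\<Sum>l\<in>L. 3 * exp (- (t * T)))"
    using centered_poisson_mgf_tail[OF M t a(1) at] by (intro sum_mono)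
  also have "\<dots> = 3 * N * exp (- H)" using t by (simp add: N_def T_def)
  also have "\<dots> = \<delta> / 4" using N \<delta> by (simp add: H_def exp_minus)
  finally have P1: "measure_pmf.prob M E1 \<le> \<delta> / 4" .
  have S1: "integrable (measure_pmf M) (\<lambda>\<omega>. exp (s * W l \<omega>))"
    and S2: "measure_pmf.expectation M (\<lambda>\<omega>. exp (s * W l \<omega>)) \<le> exp (4 * s * a l)" if "l \<in> L" for l
    unfolding s_def W_def
    using centered_poisson_mgf_truncated_square[OF M t a(1) at T] that by blast+
  have ind: "prob_space.indep_vars (measure_pmf M) (\<lambda>_. borel) (\<lambda>l \<omega>. exp (s * W l \<omega>)) L"
    unfolding W_def
    by (rule prob_space.indep_vars_compose2[OF measure_pmf.prob_space_axioms indep, where Y = "\<lambda>_ z. exp (s * (if \<bar>z\<bar> \<le> T then z\<^sup>2 else 0))"]) measurable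
  have int: "integrable (measure_pmf M) (\<lambda>\<omega>. \<Prod>l\<in>L. exp (s * W l \<omega>))"
    by (rule prob_space.indep_vars_integrable[OF measure_pmf.prob_space_axioms L(1) ind S1])
  have "measure_pmf.prob M E2
      \<le> measure_pmf.expectation M (\<lambda>\<omega>. \<Prod>l\<in>L. exp (s * W l \<omega>)) / (exp (4 * s * \<kappa>) * (4 / \<delta>))"
    unfolding E2_def using \<delta>
    by (intro integral_Markov_inequality_measure[OF int, of "{}"]) (auto intro!: AE_I2 prod_nonneg)
  also have "measure_pmf.expectation M (\<lambda>\<omega>. \<Prod>l\<in>L. exp (s * W l \<omega>))
      = (\<Prod>l\<in>L. measure_pmf.expectation M (\<lambda>\<omega>. exp (s * W l \<omega>)))"
    by (rule prob_space.indep_vars_lebesgue_integral[OF measure_pmf.prob_space_axioms L(1) ind S1])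
  also have "\<dots> \<le> (\<Prod>l\<in>L. exp (4 * s * a l))"
    using S2 by (intro prod_mono) (auto intro!: Bochner_Integration.integral_nonneg)
  also have "\<dots> = exp (4 * s * \<kappa>)" by (simp add: \<kappa>_def sum_distrib_left exp_sum[OF L(1)])
  finally have P2: "measure_pmf.prob M E2 \<le> \<delta> / 4" using \<delta> by (simp add: divide_right_mono)
  have "{\<omega>. 4 * \<kappa> + ln (4 / \<delta>) / s < (\<Sum>l\<in>L. (Z l \<omega>)\<^sup>2)} \<subseteq> E1 \<union> E2"
  proof
    fix \<omega> assume \<omega>: "\<omega> \<in> {\<omega>. 4 * \<kappa> + ln (4 / \<delta>) / s < (\<Sum>l\<in>L. (Z l \<omega>)\<^sup>2)}"
    show "\<omega> \<in> E1 \<union> E2"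
    proof (cases "\<omega> \<in> E1")
      case False
      hence "(\<Sum>l\<in>L. (Z l \<omega>)\<^sup>2) = (\<Sum>l\<in>L. W l \<omega>)"
        by (intro sum.cong refl) (auto simp: E1_def W_def)
      hence "s * (4 * \<kappa> + ln (4 / \<delta>) / s) \<le> s * (\<Sum>l\<in>L. W l \<omega>)"
        using \<omega> s by (intro mult_left_mono) auto
      hence "4 * s * \<kappa> + ln (4 / \<delta>) \<le> s * (\<Sum>l\<in>L. W l \<omega>)"
        using s by (simp add: algebra_simps)
      hence "exp (4 * s * \<kappa> + ln (4 / \<delta>)) \<le> exp (s * (\<Sum>l\<in>L. W l \<omega>))" by simp
      hence "\<omega> \<in> E2" using \<delta> by (simp add: E2_def exp_add sum_distrib_left exp_sum[OF L(1)])
      thus ?thesis ..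
    qed simp
  qed
  hence "measure_pmf.prob M {\<omega>. 4 * \<kappa> + ln (4 / \<delta>) / s < (\<Sum>l\<in>L. (Z l \<omega>)\<^sup>2)} \<le> measure_pmf.prob M (E1 \<union> E2)"
    by (intro measure_pmf.finite_measure_mono) auto
  also have "\<dots> \<le> measure_pmf.prob M E1 + measure_pmf.prob M E2"
    by (rule measure_Un_le) auto
  also have "\<dots> \<le> \<delta> / 2" using P1 P2 by simp
  finally show ?thesis unfolding thr[symmetric] \<kappa>_def H_def N_def .
qed

section \<open>Marginals of the biproportional model\<close>

context
  fixes m n :: nat and X :: "nat \<Rightarrow> nat \<Rightarrow> real" and us vs :: "nat \<Rightarrow> real"
begin

definition row_dev :: "nat \<Rightarrow> (nat \<times> nat \<Rightarrow> nat) \<Rightarrow> real" where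
  "row_dev i Y = real (rowsum n Y i) - (\<Sum>j<n. rate X us vs i j)"

definition col_dev :: "nat \<Rightarrow> (nat \<times> nat \<Rightarrow> nat) \<Rightarrow> real" where
  "col_dev j Y = real (colsum m Y j) - (\<Sum>i<m. rate X us vs i j)"

definition marginal_dev :: "(nat \<times> nat \<Rightarrow> nat) \<Rightarrow> real" where
  "marginal_dev Y = (\<Sum>i<m. (row_dev i Y)\<^sup>2) + (\<Sum>j<n. (col_dev j Y)\<^sup>2)"

lemma sum_singleton_times: "(\<Sum>k\<in>{i} \<times> {0..<n}. h k) = (\<Sum>j<n. h (i, j))" for h :: "nat \<times> nat \<Rightarrow> real"
  by (simp add: atLeast0LessThan sum.cartesian_product')

lemma sum_times_singleton: "(\<Sum>k\<in>{0..<m} \<times> {j}. h k) = (\<Sum>i<m. h (i, j))" for h :: "nat \<times> nat \<Rightarrow> real"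
  by (simp add: atLeast0LessThan sum.cartesian_product')

text \<open>Viewing a row as a block of cells lets rows and columns share the same independence and
  generating function arguments.\<close>

lemma row_dev_block:
  "row_dev = (\<lambda>i Y. \<Sum>k\<in>{i} \<times> {0..<n}. real (Y k) - case_prod (rate X us vs) k)"
  by (intro ext) (simp add: row_dev_def rowsum_def sum_singleton_times sum_subtractf)

lemma col_dev_block:
  "col_dev = (\<lambda>j Y. \<Sum>k\<in>{0..<m} \<times> {j}. real (Y k) - case_prod (rate X us vs) k)"
  by (intro ext) (simp add: col_dev_def colsum_def sum_times_singleton sum_subtractf)

lemma marginal_dev_nonneg: "0 \<le> marginal_dev Y"
  by (simp add: marginal_dev_def sum_nonneg)

lemma kappa_cols: "(\<Sum>j<n. \<Sum>i<m. rate X us vs i j) = kappa m n X us vs"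
  unfolding kappa_def by (rule sum.swap)

lemma rate_sums_le_Mmax:
  shows "i < m \<Longrightarrow> (\<Sum>j<n. rate X us vs i j) \<le> Mmax m n X us vs"
    and "j < n \<Longrightarrow> (\<Sum>i<m. rate X us vs i j) \<le> Mmax m n X us vs"
  unfolding Mmax_def by (auto intro: max.coboundedI1 max.coboundedI2)

lemma bpm_pmf_block_indep:
  assumes "\<And>l. l \<in> L \<Longrightarrow> K l \<subseteq> {0..<m} \<times> {0..<n}" "disjoint_family_on K L"
  shows "prob_space.indep_vars (measure_pmf (bpm_pmf m n X us vs)) (\<lambda>_. borel)
    (\<lambda>l Y. \<Sum>k\<in>K l. real (Y k) - case_prod (rate X us vs) k) L"
  unfolding bpm_pmf_def
  by (rule prob_space.indep_vars_sum_blocks[OF measure_pmf.prob_space_axioms indep_vars_Pi_pmf, OF _ assms]) simp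

lemma row_dev_indep: "prob_space.indep_vars (measure_pmf (bpm_pmf m n X us vs)) (\<lambda>_. borel) row_dev {..<m}"
  unfolding row_dev_block by (rule bpm_pmf_block_indep) (auto simp: disjoint_family_on_def)

lemma col_dev_indep: "prob_space.indep_vars (measure_pmf (bpm_pmf m n X us vs)) (\<lambda>_. borel) col_dev {..<n}"
  unfolding col_dev_block by (rule bpm_pmf_block_indep) (auto simp: disjoint_family_on_def)

context
  assumes X_nonneg: "\<And>i j. 0 \<le> X i j"
begin

lemma rate_nonneg: "0 \<le> rate X us vs i j"
  using X_nonneg by (simp add: rate_def)

lemma kappa_nonneg: "0 \<le> kappa m n X us vs"
  unfolding kappa_def by (intro sum_nonneg rate_nonneg)

lemma bpm_pmf_block_mgf:
  assumes "K \<subseteq> {0..<m} \<times> {0..<n}"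
  shows "centered_poisson_mgf (bpm_pmf m n X us vs)
    (\<lambda>Y. \<Sum>k\<in>K. real (Y k) - case_prod (rate X us vs) k) (\<Sum>k\<in>K. case_prod (rate X us vs) k)"
  unfolding bpm_pmf_def
proof (rule centered_poisson_mgf_sum_Pi_pmf[where Z = "\<lambda>k y. real y - case_prod (rate X us vs) k"])
  fix k assume "k \<in> K"
  obtain i j where k: "k = (i, j)" by (cases k)
  show "centered_poisson_mgf (case k of (i, j) \<Rightarrow> if X i j > 0 then poisson_pmf (rate X us vs i j) else return_pmf 0)
      (\<lambda>y. real y - case_prod (rate X us vs) k) (case_prod (rate X us vs) k)"
  proof (cases "X i j > 0")
    case True
    hence "0 < rate X us vs i j" by (simp add: rate_def)
    with True k show ?thesis by (simp add: centered_poisson_mgf_poisson_pmf)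
  next
    \<comment> \<open>A zero entry is the degenerate Poisson case of mean 0, whose transform is
      constantly 1.\<close>
    case False
    hence "rate X us vs i j = 0" using X_nonneg[of i j] by (simp add: rate_def)
    with False k show ?thesis by (simp add: centered_poisson_mgf_def has_bochner_integral_iff integrable_measure_pmf_finite)
  qed
qed (use assms in auto)

lemma row_dev_mgf: "i < m \<Longrightarrow> centered_poisson_mgf (bpm_pmf m n X us vs) (row_dev i) (\<Sum>j<n. rate X us vs i j)"
  using bpm_pmf_block_mgf[of "{i} \<times> {0..<n}"] by (simp add: row_dev_block sum_singleton_times Sigma_mono)

lemma col_dev_mgf: "j < n \<Longrightarrow> centered_poisson_mgf (bpm_pmf m n X us vs) (col_dev j) (\<Sum>i<m. rate X us vs i j)"
  using bpm_pmf_block_mgf[of "{0..<m} \<times> {j}"] by (simp add: col_dev_block sum_times_singleton Sigma_mono)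

text \<open>The row means and the column means both total \<open>kappa\<close>, so each family
  contributes \<open>4 * kappa\<close>.\<close>

lemma marginal_dev_expectation:
  shows "integrable (measure_pmf (bpm_pmf m n X us vs)) marginal_dev"
    and "measure_pmf.expectation (bpm_pmf m n X us vs) marginal_dev \<le> 8 * kappa m n X us vs"
proof -
  note R = centered_poisson_sum_squares_expectation[of "{..<m}" "bpm_pmf m n X us vs" row_dev, OF row_dev_mgf]
  note C = centered_poisson_sum_squares_expectation[of "{..<n}" "bpm_pmf m n X us vs" col_dev, OF col_dev_mgf]
  have int: "integrable (measure_pmf (bpm_pmf m n X us vs)) (\<lambda>Y. \<Sum>i<m. (row_dev i Y)\<^sup>2)"
    "integrable (measure_pmf (bpm_pmf m n X us vs)) (\<lambda>Y. \<Sum>j<n. (col_dev j Y)\<^sup>2)"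
    by (rule R(1) C(1); auto intro!: sum_nonneg rate_nonneg)+
  show "integrable (measure_pmf (bpm_pmf m n X us vs)) marginal_dev"
    unfolding marginal_dev_def[abs_def] using int by (rule Bochner_Integration.integrable_add)
  have "measure_pmf.expectation (bpm_pmf m n X us vs) (\<lambda>Y. \<Sum>i<m. (row_dev i Y)\<^sup>2) \<le> 4 * kappa m n X us vs"
    unfolding kappa_def by (rule R(2)) (auto intro!: sum_nonneg rate_nonneg)
  moreover have "measure_pmf.expectation (bpm_pmf m n X us vs) (\<lambda>Y. \<Sum>j<n. (col_dev j Y)\<^sup>2) \<le> 4 * kappa m n X us vs"
    unfolding kappa_cols[symmetric] by (rule C(2)) (auto intro!: sum_nonneg rate_nonneg)
  ultimately show "measure_pmf.expectation (bpm_pmf m n X us vs) marginal_dev \<le> 8 * kappa m n X us vs"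
    unfolding marginal_dev_def[abs_def] by (simp add: Bochner_Integration.integral_add[OF int])
qed

text \<open>Row sums and column sums share cells and are not jointly independent in general. The
  tail bound is therefore applied to each family separately at cost \<open>\<delta> / 2\<close>, and
  a union bound joins them.\<close>

lemma marginal_dev_tail:
  assumes mn: "0 < m" "0 < n" and \<delta>: "0 < \<delta>" "\<delta> < 1"
  defines "M \<equiv> Mmax m n X us vs"
  shows "1 - \<delta> \<le> measure_pmf.prob (bpm_pmf m n X us vs)
    {Y. marginal_dev Y \<le> 8 * kappa m n X us vs
      + 64 * (1 + M) * ln (4 / \<delta>) * (ln (12 * real m / \<delta>) + ln (12 * real n / \<delta>))}"
proof -
  let ?P = "bpm_pmf m n X us vs"
  let ?R = "{Y. 4 * kappa m n X us vs + 64 * (1 + M) * ln (4 / \<delta>) * ln (12 * real m / \<delta>) < (\<Sum>i<m. (row_dev i Y)\<^sup>2)}"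
  let ?C = "{Y. 4 * kappa m n X us vs + 64 * (1 + M) * ln (4 / \<delta>) * ln (12 * real n / \<delta>) < (\<Sum>j<n. (col_dev j Y)\<^sup>2)}"
  let ?G = "{Y. marginal_dev Y \<le> 8 * kappa m n X us vs
      + 64 * (1 + M) * ln (4 / \<delta>) * (ln (12 * real m / \<delta>) + ln (12 * real n / \<delta>))}"
  have R: "measure_pmf.prob ?P ?R \<le> \<delta> / 2"
  proof -
    have "measure_pmf.prob ?P {Y. 4 * (\<Sum>i<m. \<Sum>j<n. rate X us vs i j)
        + 64 * (1 + M) * ln (4 / \<delta>) * ln (12 * real (card {..<m}) / \<delta>) < (\<Sum>i<m. (row_dev i Y)\<^sup>2)} \<le> \<delta> / 2"
    proof (rule centered_poisson_sum_squares_tail[OF row_dev_mgf row_dev_indep])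
      show "(\<Sum>j<n. rate X us vs i j) \<le> M" if "i \<in> {..<m}" for i
        using that by (simp add: M_def rate_sums_le_Mmax)
    qed (use mn \<delta> in \<open>auto intro!: sum_nonneg rate_nonneg\<close>)
    thus ?thesis by (simp add: kappa_def)
  qed
  have C: "measure_pmf.prob ?P ?C \<le> \<delta> / 2"
  proof -
    have "measure_pmf.prob ?P {Y. 4 * (\<Sum>j<n. \<Sum>i<m. rate X us vs i j)
        + 64 * (1 + M) * ln (4 / \<delta>) * ln (12 * real (card {..<n}) / \<delta>) < (\<Sum>j<n. (col_dev j Y)\<^sup>2)} \<le> \<delta> / 2"
    proof (rule centered_poisson_sum_squares_tail[OF col_dev_mgf col_dev_indep])
      show "(\<Sum>i<m. rate X us vs i j) \<le> M" if "j \<in> {..<n}" for j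
        using that by (simp add: M_def rate_sums_le_Mmax)
    qed (use mn \<delta> in \<open>auto intro!: sum_nonneg rate_nonneg\<close>)
    thus ?thesis by (simp add: kappa_cols)
  qed
  have "- ?G \<subseteq> ?R \<union> ?C" by (auto simp: marginal_dev_def algebra_simps)
  hence "measure_pmf.prob ?P (- ?G) \<le> measure_pmf.prob ?P (?R \<union> ?C)"
    by (intro measure_pmf.finite_measure_mono) auto
  also have "\<dots> \<le> measure_pmf.prob ?P ?R + measure_pmf.prob ?P ?C"
    by (rule measure_Un_le) auto
  also have "\<dots> \<le> \<delta>" using R C by simp
  finally show ?thesis using measure_pmf.prob_compl[of ?G ?P] by (simp add: Compl_eq_Diff_UNIV)
qed

end

end

section \<open>From marginal deviations to the error of the estimator\<close>

lemma event_B_sq_err_le: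
  assumes set: "setting m n X us vs B est" and Y: "event_B m n X us vs B Y"
  shows "sq_err m n us vs (est (rowsum n Y) (colsum m Y))
    \<le> exp (4 * B) / (lambda_2 (laplacian m n X))\<^sup>2 * marginal_dev m n X us vs Y"
proof -
  have X: "0 \<le> X i j" and lam: "0 < lambda_2 (laplacian m n X)" for i j
    using set by (simp_all add: setting_def)
  obtain uh vh where e: "est (rowsum n Y) (colsum m Y) = (uh, vh)" by fastforce
  \<comment> \<open>On the event the selection returns some good maximizer; the deterministic bound
    holds for each of them, whichever is chosen.\<close>
  have "good_mle m n X us vs B (rowsum n Y) (colsum m Y)
     (fst (est (rowsum n Y) (colsum m Y))) (snd (est (rowsum n Y) (colsum m Y)))"
    using set Y unfolding setting_def event_B_def by blast
  hence "good_mle m n X us vs B (rowsum n Y) (colsum m Y) uh vh" by (simp add: e)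
  from good_mle_sq_err_le[OF this X lam] show ?thesis
    by (simp add: e marginal_dev_def row_dev_def col_dev_def)
qed

text \<open>Both \<open>12 / \<delta>\<close> and \<open>1 + real (m + n)\<close> are at least 3,
  hence at least e, so their logarithms are at least 1. Sums of these logarithms can then be
  replaced by products, giving the shape of the final bound.\<close>

lemma log_factor_le:
  fixes \<delta> :: real
  assumes mn: "0 < m" "0 < n" and \<delta>: "0 < \<delta>" "\<delta> < 1"
  shows "ln (4 / \<delta>) * (ln (12 * real m / \<delta>) + ln (12 * real n / \<delta>))
    \<le> 4 * (ln (12 / \<delta>))\<^sup>2 * (ln (1 + real (m + n)))\<^sup>2"
proof -
  define l where "l = ln (12 / \<delta>)"
  define g where "g = ln (1 + real (m + n))"
  have e3: "exp 1 \<le> (3 :: real)" using exp_le by simp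
  have "12 \<le> 12 / \<delta>" using \<delta> by (simp add: field_simps)
  hence "exp 1 \<le> 12 / \<delta>" using e3 by linarith
  hence l: "1 \<le> l" using \<delta> by (simp add: l_def ln_ge_iff)
  have g: "1 \<le> g" using mn e3 by (simp add: g_def ln_ge_iff)
  have *: "ln (12 * real k / \<delta>) \<le> 2 * (l * g\<^sup>2)" if k: "0 < k" "k \<le> m + n" for k
  proof -
    have "ln (12 * real k / \<delta>) = l + ln (real k)"
      using k \<delta> by (simp add: l_def ln_mult ln_div)
    also have "ln (real k) \<le> g" using k by (simp add: g_def)
    also have "l + g \<le> 2 * (l * g)"
    proof -
      have "l * 1 \<le> l * g" "1 * g \<le> l * g" using l g by (intro mult_left_mono mult_right_mono; simp)+
      thus ?thesis by simp
    qed
    also have "\<dots> \<le> 2 * (l * g\<^sup>2)"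
      using l g by (simp add: power2_eq_square)
    finally show ?thesis by simp
  qed
  have "ln (4 / \<delta>) \<le> l" using \<delta> by (simp add: l_def divide_right_mono)
  moreover have "0 \<le> ln (4 / \<delta>)" using \<delta> by simp
  moreover have "ln (12 * real m / \<delta>) + ln (12 * real n / \<delta>) \<le> 4 * (l * g\<^sup>2)"
    using *[of m] *[of n] mn by simp
  ultimately have "ln (4 / \<delta>) * (ln (12 * real m / \<delta>) + ln (12 * real n / \<delta>)) \<le> l * (4 * (l * g\<^sup>2))"
    using l by (intro order_trans[OF mult_left_mono mult_right_mono]) auto
  thus ?thesis by (simp add: l_def g_def power2_eq_square mult_ac)
qed

lemma expected_sq_err_le:
  assumes set: "setting m n X us vs B est"
  shows "measure_pmf.expectation (bpm_pmf m n X us vs)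
             (\<lambda>Y. if event_B m n X us vs B Y
                   then sq_err m n us vs (est (rowsum n Y) (colsum m Y)) else 0)
           \<le> 8 * exp (4 * B) * kappa m n X us vs / (lambda_2 (laplacian m n X))\<^sup>2"
proof -
  have X: "0 \<le> X i j" for i j using set by (simp add: setting_def)
  let ?c = "exp (4 * B) / (lambda_2 (laplacian m n X))\<^sup>2"
  let ?S = "marginal_dev m n X us vs"
  have c: "0 \<le> ?c" by simp
  have "measure_pmf.expectation (bpm_pmf m n X us vs)
             (\<lambda>Y. if event_B m n X us vs B Y
                   then sq_err m n us vs (est (rowsum n Y) (colsum m Y)) else 0)
      \<le> measure_pmf.expectation (bpm_pmf m n X us vs) (\<lambda>Y. ?c * ?S Y)"
    \<comment> \<open>This comparison asks for integrability and nonnegativity of the dominating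
      function only.\<close>
    by (rule integral_mono_AE')
       (use marginal_dev_expectation(1)[where X = X, OF X] event_B_sq_err_le[OF set] marginal_dev_nonneg c
        in \<open>auto intro!: AE_I2 mult_nonneg_nonneg\<close>)
  also have "\<dots> = ?c * measure_pmf.expectation (bpm_pmf m n X us vs) ?S" by simp
  also have "\<dots> \<le> ?c * (8 * kappa m n X us vs)"
    using marginal_dev_expectation(2)[where X = X, OF X] c by (rule mult_left_mono)
  finally show ?thesis by (simp add: mult_ac)
qed

lemma sq_err_tail:
  assumes set: "setting m n X us vs B est" and \<delta>: "0 < \<delta>" "\<delta> < 1"
  shows "1 - \<delta> \<le> measure_pmf.prob (bpm_pmf m n X us vs)
             {Y. event_B m n X us vs B Y \<longrightarrow>
                 sq_err m n us vs (est (rowsum n Y) (colsum m Y))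
                 \<le> 8 * exp (4 * B) / (lambda_2 (laplacian m n X))\<^sup>2
                    * (kappa m n X us vs
                       + sqrt (6 * ln (4 / \<delta>) * kappa m n X us vs * (1 + Mmax m n X us vs))
                       + 32 * (ln (12 / \<delta>))\<^sup>2 * (ln (1 + real (m + n)))\<^sup>2 * (1 + Mmax m n X us vs))}"
    (is "_ \<le> measure_pmf.prob _ {Y. _ \<longrightarrow> _ \<le> ?b}")
proof -
  have X: "0 \<le> X i j" for i j using set by (simp add: setting_def)
  have mn: "0 < m" "0 < n" using set by (simp_all add: setting_def)
  let ?c = "exp (4 * B) / (lambda_2 (laplacian m n X))\<^sup>2"
  define M where "M = Mmax m n X us vs"
  define \<kappa> where "\<kappa> = kappa m n X us vs"
  define L where "L = ln (4 / \<delta>) * (ln (12 * real m / \<delta>) + ln (12 * real n / \<delta>))"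
  define Q where "Q = (ln (12 / \<delta>))\<^sup>2 * (ln (1 + real (m + n)))\<^sup>2"
  have "0 \<le> (\<Sum>j<n. rate X us vs 0 j)" using X by (intro sum_nonneg rate_nonneg)
  hence M: "0 \<le> M" using rate_sums_le_Mmax(1)[OF mn(1), where n = n and X = X and us = us and vs = vs] by (simp add: M_def)
  have "1 - \<delta> \<le> measure_pmf.prob (bpm_pmf m n X us vs)
      {Y. marginal_dev m n X us vs Y \<le> 8 * \<kappa> + 64 * (1 + M) * L}"
    using marginal_dev_tail[where X = X and us = us and vs = vs, OF X mn \<delta>] by (simp add: M_def \<kappa>_def L_def mult.assoc)
  also have "\<dots> \<le> measure_pmf.prob (bpm_pmf m n X us vs)
      {Y. event_B m n X us vs B Y \<longrightarrow> sq_err m n us vs (est (rowsum n Y) (colsum m Y)) \<le> ?b}"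
  proof (intro measure_pmf.finite_measure_mono subsetI CollectI impI)
    fix Y assume Y: "Y \<in> {Y. marginal_dev m n X us vs Y \<le> 8 * \<kappa> + 64 * (1 + M) * L}"
      and "event_B m n X us vs B Y"
    hence "sq_err m n us vs (est (rowsum n Y) (colsum m Y)) \<le> ?c * marginal_dev m n X us vs Y"
      using event_B_sq_err_le[OF set] by blast
    also have "\<dots> \<le> ?c * (8 * \<kappa> + 64 * (1 + M) * L)" using Y by (intro mult_left_mono) auto
    also have "\<dots> \<le> ?c * (8 * \<kappa> + 64 * (1 + M) * (4 * Q))"
      using log_factor_le[OF mn \<delta>] M
      by (intro mult_left_mono add_left_mono) (auto simp: L_def Q_def mult.assoc)
    \<comment> \<open>The identity 64 * 4 = 8 * 32 fixes the absolute constant; the square root is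
      nonnegative, so adding it preserves the bound.\<close>
    also have "\<dots> \<le> ?c * (8 * (\<kappa> + sqrt (6 * ln (4 / \<delta>) * \<kappa> * (1 + M)) + 32 * Q * (1 + M)))"
    proof (rule mult_left_mono)
      have "0 \<le> sqrt (6 * ln (4 / \<delta>) * \<kappa> * (1 + M))"
        using \<delta> M kappa_nonneg[where X = X, OF X] by (simp add: \<kappa>_def)
      thus "8 * \<kappa> + 64 * (1 + M) * (4 * Q) \<le> 8 * (\<kappa> + sqrt (6 * ln (4 / \<delta>) * \<kappa> * (1 + M)) + 32 * Q * (1 + M))"
        by (simp add: algebra_simps)
    qed simp
    also have "\<dots> = ?b" by (simp add: \<kappa>_def M_def Q_def mult_ac)
    finally show "sq_err m n us vs (est (rowsum n Y) (colsum m Y)) \<le> ?b" .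
  qed auto
  finally show ?thesis .
qed

theorem mainTheorem4:
  shows "(\<forall>m n X us vs B est. setting m n X us vs B est \<longrightarrow>
           measure_pmf.expectation (bpm_pmf m n X us vs)
             (\<lambda>Y. if event_B m n X us vs B Y
                   then sq_err m n us vs (est (rowsum n Y) (colsum m Y)) else 0)
           \<le> 8 * exp (4 * B) * kappa m n X us vs / (lambda_2 (laplacian m n X))^2)
       \<and> (\<exists>C>0. \<forall>m n X us vs B est \<delta>. setting m n X us vs B est \<and> 0 < \<delta> \<and> \<delta> < 1 \<longrightarrow>
           1 - \<delta> \<le> measure_pmf.prob (bpm_pmf m n X us vs)
             {Y. event_B m n X us vs B Y \<longrightarrow>
                 sq_err m n us vs (est (rowsum n Y) (colsum m Y))
                 \<le> 8 * exp (4 * B) / (lambda_2 (laplacian m n X))^2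
                    * (kappa m n X us vs
                       + sqrt (6 * ln (4 / \<delta>) * kappa m n X us vs * (1 + Mmax m n X us vs))
                       + C * (ln (12 / \<delta>))^2 * (ln (1 + real (m + n)))^2 * (1 + Mmax m n X us vs))})"
  (is "?expectation \<and> (\<exists>C>0. ?tail C)")
proof
  show ?expectation using expected_sq_err_le by simp
  have "?tail 32" using sq_err_tail by simp
  thus "\<exists>C>0. ?tail C" by (rule exI[of _ 32, OF conjI, rotated]) simp
qed

end
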